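(* Let $G=(V,E)$ be an unoriented, connected, infinite graph without self-loops with $\Delta=\sup_{x\in V}\deg(x)<\infty$. (1) Let $j$ be an integer with $1\le j\le\delta(G)$ which is $\chi$-good, and let $\chi$ be the $j$-threshold Consensus Process with $\varepsilon$-noise on $G$. If $\varepsilon$ is sufficiently small (i.e. for all $\varepsilon\in[0,\varepsilon_0]$ for some $\varepsilon_0>0$), then $\chi$ has multiple invariant measures and there exists $0<c<\tfrac12$ such that $\mathbb{P}[\chi^{\mathbf 1}_x(t)=0]\le c$ for every integer $t\ge1$ and every $x\in V$. (2) Assume that $\lfloor \Delta/2+1\rfloor$ is $\chi$-good, and let $\sigma$ be the Majority Vote Process with $\varepsilon$-noise on $G$. If $\varepsilon$ is sufficiently small (i.e. for all $\varepsilon\in[0,\varepsilon_0]$ for some $\varepsilon_0>0$), then $\sigma$ has multiple invariant measures and there exists $0<c<\tfrac12$ such that $\mathbb{P}[\sigma^{\mathbf 1}_x(t)=0]\le c$ for every integer $t\ge1$ and every $x\in V$.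
   Context: Write $x\sim y$ if $\{x,y\}\in E$, $N(x)=\{y: y\sim x\}$, $\deg(x)=|N(x)|$, $\delta(G)=\inf_{x\in V}\deg(x)$. Configurations are elements of $\Omega=\{0,1\}^V$; $c_x(\eta)=\sum_{y\sim x}\eta_y$; $\mathbf 1$ is the constant-one configuration; a superscript $\mathbf 1$ on a process means it is started at time $0$ from $\mathbf 1$. Let $(L_x(t))_{x\in V,\,t\in\mathbb{N}_{\ge1}}$ be independent uniform random variables on $[0,1]$, independent of the initial configuration. The $j$-threshold Consensus Process with $\varepsilon$-noise is the discrete-time Markov process $\chi$ on $\Omega$ defined for $t\ge1$, $x\in V$ by $\chi_x(t)=\mathbb{1}\{c_x(\chi(t-1))\ge j\}$ if $L_x(t)\in[\varepsilon,1]$, and $\chi_x(t)=0$ if $L_x(t)\in[0,\varepsilon)$. The $\varepsilon$-noise Majority Vote Process is the discrete-time Markov process $\sigma$ on $\Omega$ defined for $t\ge1$, $x\in V$ as follows. If $L_x(t)\in[\varepsilon,1]$: $\sigma_x(t)=0$ when $c_x(\sigma(t-1))<\deg(x)/2$, $\sigma_x(t)=1$ when $c_x(\sigma(t-1))>\deg(x)/2$, and $\sigma_x(t)=\sigma_x(t-1)$ when $c_x(\sigma(t-1))=\deg(x)/2$. If $L_x(t)\in[0,\varepsilon/2)$: $\sigma_x(t)=0$. If $L_x(t)\in[\varepsilon/2,\varepsilon)$: $\sigma_x(t)=1$. $\chi$-good: let $\Phi_E=\inf\{|\partial_E K|/|K|\}$ and $\Phi_V=\inf\{|\partial_V K|/|K|\}$,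 both infima over finite nonempty $K\subset V$, where $\partial_E K$ is the set of edges with exactly one endpoint in $K$ and $\partial_V K=\{x\notin K:\exists y\in K,\ x\sim y\}$. An integer $j$ with $1\le j\le\delta(G)$ is $\chi$-good if at least one of the following holds: (i) $2j<3\Phi_E-\Delta+2$; (ii) $G$ is bipartite and $j<\Phi_E+1$; (iii) $j<\Phi_V$; (iv) $G$ is the $d$-regular tree, with $d\ge2$, and $j<d$. *)

theory Defs
  imports "HOL-Probability.Probability"
begin

section \<open>Graphs\<close>

definition simple_graph :: "'v set \<Rightarrow> 'v set set \<Rightarrow> bool" where
  "simple_graph V E \<longleftrightarrow> (\<forall>e\<in>E. e \<subseteq> V \<and> card e = 2)"

definition adj :: "'v set set \<Rightarrow> 'v \<Rightarrow> 'v \<Rightarrow> bool" where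
  "adj E x y \<longleftrightarrow> {x, y} \<in> E"

definition nbrs :: "'v set set \<Rightarrow> 'v \<Rightarrow> 'v set" where
  "nbrs E x = {y. adj E y x}"

definition deg :: "'v set set \<Rightarrow> 'v \<Rightarrow> nat" where
  "deg E x = card (nbrs E x)"

definition connected_graph :: "'v set \<Rightarrow> 'v set set \<Rightarrow> bool" where
  "connected_graph V E \<longleftrightarrow> (\<forall>x\<in>V. \<forall>y\<in>V. (adj E)\<^sup>*\<^sup>* x y)"

text \<open>
  The condition \<open>\<Delta> < \<infinity>\<close>. Finiteness of the neighbourhoods is required explicitly because
  \<^const>\<open>deg\<close> is \<open>0\<close> at a vertex with infinitely many neighbours.
\<close>
definition bounded_degree :: "'v set \<Rightarrow> 'v set set \<Rightarrow> bool" where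
  "bounded_degree V E \<longleftrightarrow> (\<forall>x\<in>V. finite (nbrs E x)) \<and> bdd_above (deg E ` V)"

definition max_degree :: "'v set \<Rightarrow> 'v set set \<Rightarrow> nat" where
  "max_degree V E = (SUP x\<in>V. deg E x)"

definition min_degree :: "'v set \<Rightarrow> 'v set set \<Rightarrow> nat" where
  "min_degree V E = (INF x\<in>V. deg E x)"

definition edge_boundary :: "'v set set \<Rightarrow> 'v set \<Rightarrow> 'v set set" where
  "edge_boundary E K = {e\<in>E. card (e \<inter> K) = 1}"

definition vertex_boundary :: "'v set \<Rightarrow> 'v set set \<Rightarrow> 'v set \<Rightarrow> 'v set" where
  "vertex_boundary V E K = {x\<in>V. x \<notin> K \<and> (\<exists>y\<in>K. adj E x y)}"

definition Phi_E :: "'v set \<Rightarrow> 'v set set \<Rightarrow> real" where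
  "Phi_E V E = (INF K\<in>{K. K \<subseteq> V \<and> finite K \<and> K \<noteq> {}}.
     real (card (edge_boundary E K)) / real (card K))"

definition Phi_V :: "'v set \<Rightarrow> 'v set set \<Rightarrow> real" where
  "Phi_V V E = (INF K\<in>{K. K \<subseteq> V \<and> finite K \<and> K \<noteq> {}}.
     real (card (vertex_boundary V E K)) / real (card K))"

definition bipartite :: "'v set \<Rightarrow> 'v set set \<Rightarrow> bool" where
  "bipartite V E \<longleftrightarrow>
     (\<exists>A B. A \<union> B = V \<and> A \<inter> B = {} \<and> (\<forall>e\<in>E. e \<inter> A \<noteq> {} \<and> e \<inter> B \<noteq> {}))"

definition has_cycle :: "'v set set \<Rightarrow> bool" where
  "has_cycle E \<longleftrightarrow>
     (\<exists>xs. 3 \<le> length xs \<and> distinct xs \<and> successively (adj E) xs \<and> adj E (last xs) (hd xs))"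

definition regular_tree :: "'v set \<Rightarrow> 'v set set \<Rightarrow> nat \<Rightarrow> bool" where
  "regular_tree V E d \<longleftrightarrow>
     connected_graph V E \<and> \<not> has_cycle E \<and> (\<forall>x\<in>V. deg E x = d)"

definition chi_good :: "'v set \<Rightarrow> 'v set set \<Rightarrow> nat \<Rightarrow> bool" where
  "chi_good V E j \<longleftrightarrow> 1 \<le> j \<and> j \<le> min_degree V E \<and>
     (2 * real j < 3 * Phi_E V E - real (max_degree V E) + 2
      \<or> bipartite V E \<and> real j < Phi_E V E + 1
      \<or> real j < Phi_V V E
      \<or> (\<exists>d\<ge>2. regular_tree V E d \<and> j < d))"

section \<open>Configurations and the two dynamics\<close>

text \<open>
  \<open>\<Omega> = {0,1}\<^sup>V\<close> with its product sigma-algebra; the elements of the space are the functions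
  with values in \<open>{0,1}\<close> on \<open>V\<close> that are \<^const>\<open>undefined\<close> outside \<open>V\<close>.
\<close>
definition configs :: "'v set \<Rightarrow> ('v \<Rightarrow> nat) measure" where
  "configs V = (\<Pi>\<^sub>M x\<in>V. count_space {0, 1})"

definition all_ones :: "'v set \<Rightarrow> 'v \<Rightarrow> nat" where
  "all_ones V = (\<lambda>x\<in>V. 1)"

definition nbr_count :: "'v set set \<Rightarrow> ('v \<Rightarrow> nat) \<Rightarrow> 'v \<Rightarrow> nat" where
  "nbr_count E \<eta> x = (\<Sum>y\<in>nbrs E x. \<eta> y)"

text \<open>
  One update of each process; \<open>l x\<close> is the value of the uniform variable used at \<open>x\<close>. The values
  assigned for \<open>l x\<close> outside \<open>[0,1]\<close> are immaterial, as this is a null event.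
\<close>
definition consensus_step ::
  "'v set \<Rightarrow> 'v set set \<Rightarrow> nat \<Rightarrow> real \<Rightarrow> ('v \<Rightarrow> real) \<Rightarrow> ('v \<Rightarrow> nat) \<Rightarrow> ('v \<Rightarrow> nat)" where
  "consensus_step V E j \<epsilon> l \<eta> = (\<lambda>x\<in>V.
     if l x \<in> {\<epsilon>..1} then (if nbr_count E \<eta> x \<ge> j then 1 else 0) else 0)"

definition majority_step ::
  "'v set \<Rightarrow> 'v set set \<Rightarrow> real \<Rightarrow> ('v \<Rightarrow> real) \<Rightarrow> ('v \<Rightarrow> nat) \<Rightarrow> ('v \<Rightarrow> nat)" where
  "majority_step V E \<epsilon> l \<eta> = (\<lambda>x\<in>V.
     if l x \<in> {\<epsilon>..1} then
       (if real (nbr_count E \<eta> x) < real (deg E x) / 2 then 0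
        else if real (nbr_count E \<eta> x) > real (deg E x) / 2 then 1
        else \<eta> x)
     else if l x \<in> {0..<\<epsilon>/2} then 0 else 1)"

text \<open>
  The trajectory driven by the realisation \<open>l x t\<close> (\<open>t \<ge> 1\<close>) of the noise and started from \<open>\<eta>\<close>;
  the values \<open>l x 0\<close> are not used.
\<close>
primrec trajectory ::
  "(('v \<Rightarrow> real) \<Rightarrow> ('v \<Rightarrow> nat) \<Rightarrow> ('v \<Rightarrow> nat)) \<Rightarrow> ('v \<Rightarrow> nat \<Rightarrow> real) \<Rightarrow> ('v \<Rightarrow> nat) \<Rightarrow> nat
    \<Rightarrow> ('v \<Rightarrow> nat)" where
  "trajectory step l \<eta> 0 = \<eta>"
| "trajectory step l \<eta> (Suc t) = step (\<lambda>x. l x (Suc t)) (trajectory step l \<eta> t)"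

definition iid_uniform_noise :: "'v set \<Rightarrow> 'w measure \<Rightarrow> ('v \<Rightarrow> nat \<Rightarrow> 'w \<Rightarrow> real) \<Rightarrow> bool" where
  "iid_uniform_noise V M L \<longleftrightarrow>
     prob_space M \<and>
     prob_space.indep_vars M (\<lambda>_. borel) (\<lambda>(x, t). L x t) (V \<times> {1..}) \<and>
     (\<forall>x\<in>V. \<forall>t\<ge>1. distr M borel (L x t) = uniform_measure lborel {0..1})"

section \<open>Invariant measures\<close>

definition transition_kernel ::
  "'v set \<Rightarrow> (('v \<Rightarrow> real) \<Rightarrow> ('v \<Rightarrow> nat) \<Rightarrow> ('v \<Rightarrow> nat)) \<Rightarrow> ('v \<Rightarrow> nat) \<Rightarrow> ('v \<Rightarrow> nat) measure" where
  "transition_kernel V step \<eta> =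
     distr (\<Pi>\<^sub>M x\<in>V. uniform_measure lborel {0..1}) (configs V) (\<lambda>l. step l \<eta>)"

definition invariant_measure ::
  "'v set \<Rightarrow> (('v \<Rightarrow> real) \<Rightarrow> ('v \<Rightarrow> nat) \<Rightarrow> ('v \<Rightarrow> nat)) \<Rightarrow> ('v \<Rightarrow> nat) measure \<Rightarrow> bool" where
  "invariant_measure V step \<mu> \<longleftrightarrow>
     prob_space \<mu> \<and> sets \<mu> = sets (configs V) \<and>
     (\<forall>A\<in>sets (configs V). (\<integral>\<^sup>+ \<eta>. emeasure (transition_kernel V step \<eta>) A \<partial>\<mu>) = emeasure \<mu> A)"

definition multiple_invariant_measures ::
  "'v set \<Rightarrow> (('v \<Rightarrow> real) \<Rightarrow> ('v \<Rightarrow> nat) \<Rightarrow> ('v \<Rightarrow> nat)) \<Rightarrow> bool" where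
  "multiple_invariant_measures V step \<longleftrightarrow>
     (\<exists>\<mu> \<nu>. invariant_measure V step \<mu> \<and> invariant_measure V step \<nu> \<and> \<mu> \<noteq> \<nu>)"

end

theory Submission imports Defs begin

text \<open>
  A zero of the consensus process at \<open>(x, t)\<close> that is not caused by the noise at \<open>(x, t)\<close>
  forces many zeros among the neighbours of \<open>x\<close> at time \<open>t - 1\<close>. Since there is no zero at
  time \<open>0\<close>, the zeros behind \<open>(x, t)\<close> must end in noise. The heart of the proof is that
  they contain a connected space-time set around \<open>(x, t)\<close> in which the noise has a
  positive density, bounded below independently of \<open>x\<close>, \<open>t\<close> and the noise level
  (\<open>chi_good_error_cluster\<close>). A connected set of \<open>n\<close> points is covered by a walk of length
  less than \<open>2n\<close>, so there are exponentially many of them, whereas the noise takes the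
  required points with probability at most a large power of \<open>\<epsilon>\<close>. Summation over all sets
  gives \<open>P[\<chi>\<^sub>x(t) = 0] \<le> 1/3\<close> (\<open>peierls_estimate\<close>).

  The first three conditions for being \<open>\<chi>\<close>-good each imply \<open>j < \<Phi>\<^sub>E + 1\<close>, because
  \<open>\<Phi>\<^sub>V \<le> \<Phi>\<^sub>E \<le> \<Delta>\<close>. Under this inequality, take all zeros behind \<open>(x, t)\<close>. Let \<open>K\<close> be those
  at time \<open>s\<close> that are not noise and \<open>A\<close> those at time \<open>s - 1\<close>. Few edges lead from \<open>K\<close>
  out of \<open>A\<close>, and the expansion of the graph, applied to \<open>K \<inter> A\<close> and \<open>K \<union> A\<close>, forces many
  edges from \<open>A\<close> out of \<open>K\<close>. Hence the weight \<open>\<Sum> (deg - \<Phi>\<^sub>E)\<close> grows from \<open>K\<close> to \<open>A\<close> by an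
  amount proportional to the size of \<open>K\<close> (\<open>backward_growth\<close>). Only noise can absorb this
  weight.

  On the \<open>d\<close>-regular tree it suffices to treat \<open>j = d - 1\<close>, since a smaller threshold
  yields fewer zeros. This case is the borderline for the expansion argument: on the line,
  all the zeros behind a point may form a triangle whose noise is only its base. Here a
  connected piece of the boundary of the set of zeros is extracted. Zeros at one time are
  organised in paths, every second vertex of a geodesic being zero. Going back one time
  unit, a path with \<open>a\<close> points becomes one with \<open>a + 1\<close> points, unless noise or a one cuts
  it; only its two ends are put into the set. Pieces that are separated by a cut have
  disjoint pasts, since a one at a vertex requires ones at all but at most one of its
  neighbours at the time before, so that a separating one survives. Induction then gives
  \<open>|S| + 2a \<le> 3 |noise in S|\<close> (\<open>tree_cluster\<close>).

  If \<open>j > \<Delta>/2\<close>, the majority process from all ones lies above the consensus process, and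
  so does the flipped majority process from all zeros, under the same noise. Finally, both
  processes are monotone, so coupling from the past converges from either extreme initial
  configuration, and the laws of the limits are invariant (\<open>stationary_limit\<close>). The limit
  from all ones has few zeros and the limit from all zeros has few ones, hence the two
  laws differ.
\<close>

section \<open>Connected sets and the walks that cover them\<close>

definition connected_in :: "('a \<Rightarrow> 'a \<Rightarrow> bool) \<Rightarrow> 'a set \<Rightarrow> bool" where
  "connected_in R S \<longleftrightarrow> (\<forall>p\<in>S. \<forall>q\<in>S. (\<lambda>a b. a \<in> S \<and> b \<in> S \<and> R a b)\<^sup>*\<^sup>* p q)"

lemma connected_in_singleton: "connected_in R {p}"
  by (simp add: connected_in_def)

lemma connected_in_Un:
  assumes "symp R" "connected_in R S" "connected_in R T" "a \<in> S" "b \<in> T" "R a b"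
  shows "connected_in R (S \<union> T)"
proof -
  let ?R = "\<lambda>U a b. a \<in> U \<and> b \<in> U \<and> R a b"
  have inS: "(?R (S \<union> T))\<^sup>*\<^sup>* p q" if "p \<in> S" "q \<in> S" for p q
  proof -
    have "(?R S)\<^sup>*\<^sup>* p q" using assms(2) that by (simp add: connected_in_def)
    then show ?thesis by (rule rtranclp_mono[THEN predicate2D, rotated]) auto
  qed
  have inT: "(?R (S \<union> T))\<^sup>*\<^sup>* p q" if "p \<in> T" "q \<in> T" for p q
  proof -
    have "(?R T)\<^sup>*\<^sup>* p q" using assms(3) that by (simp add: connected_in_def)
    then show ?thesis by (rule rtranclp_mono[THEN predicate2D, rotated]) auto
  qed
  have ab: "(?R (S \<union> T))\<^sup>*\<^sup>* a b" "(?R (S \<union> T))\<^sup>*\<^sup>* b a"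
    using assms(1,4-6) by (auto intro!: r_into_rtranclp dest: sympD)
  have "(?R (S \<union> T))\<^sup>*\<^sup>* p q" if pq: "p \<in> S \<union> T" "q \<in> S \<union> T" for p q
  proof -
    have "(?R (S \<union> T))\<^sup>*\<^sup>* p a"
      using pq(1) inS[of p a] inT[of p b] ab assms(4,5) by (meson UnE rtranclp_trans)
    moreover have "(?R (S \<union> T))\<^sup>*\<^sup>* a q"
      using pq(2) inS[of a q] inT[of b q] ab assms(4,5) by (meson UnE rtranclp_trans)
    ultimately show ?thesis by (rule rtranclp_trans)
  qed
  then show ?thesis unfolding connected_in_def by blast
qed

lemma connected_in_insert:
  assumes "symp R" "connected_in R S" "b \<in> S" "R a b"
  shows "connected_in R (insert a S)"
  using connected_in_Un[OF assms(1) connected_in_singleton assms(2) _ assms(3), of a] assms(4)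
  by simp

lemma connected_in_from_root:
  assumes "symp R" "\<And>q. q \<in> S \<Longrightarrow> (\<lambda>a b. a \<in> S \<and> b \<in> S \<and> R a b)\<^sup>*\<^sup>* p q"
  shows "connected_in R S"
proof -
  have "symp (\<lambda>a b. a \<in> S \<and> b \<in> S \<and> R a b)" using assms(1) by (auto simp: symp_def)
  then have "symp (\<lambda>a b. a \<in> S \<and> b \<in> S \<and> R a b)\<^sup>*\<^sup>*" by (rule symp_rtranclp)
  then show ?thesis
    unfolding connected_in_def using assms(2) by (meson rtranclp_trans sympD)
qed

text \<open>
  A walk grows by two steps whenever a new element is attached to it: splice in the excursion to
  the new neighbour and back.
\<close>
lemma connected_set_covered_by_walk:
  assumes "symp R" "finite S" "connected_in R S" "p \<in> S"
  shows "\<exists>xs. xs \<noteq> [] \<and> hd xs = p \<and> successively R xs \<and> set xs = S \<and> length xs < 2 * card S"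
proof -
  have "\<exists>xs. xs \<noteq> [] \<and> hd xs = p \<and> successively R xs \<and> set xs \<subseteq> S \<and> card (set xs) = n
          \<and> length xs < 2 * n" if "0 < n" "n \<le> card S" for n
    using that
  proof (induction n rule: nat_induct_non_zero)
    case 1
    then show ?case using assms(4) by (intro exI[of _ "[p]"]) auto
  next
    case (Suc n)
    then obtain xs where xs: "xs \<noteq> []" "hd xs = p" "successively R xs" "set xs \<subseteq> S"
      "card (set xs) = n" "length xs < 2 * n" by auto
    then obtain q where q: "q \<in> S" "q \<notin> set xs"
      using Suc.prems by (metis Suc_n_not_le_n subset_antisym subsetI)
    have "(\<lambda>a b. a \<in> S \<and> b \<in> S \<and> R a b)\<^sup>*\<^sup>* p q"
      using assms(3,4) q(1) by (auto simp: connected_in_def)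
    moreover have "p \<in> set xs" using xs by (metis hd_in_set)
    ultimately have "\<exists>u v. u \<in> set xs \<and> v \<notin> set xs \<and> v \<in> S \<and> R u v"
      using q(2) by (induction rule: rtranclp_induct) auto
    then obtain u v where uv: "u \<in> set xs" "v \<notin> set xs" "v \<in> S" "R u v" by blast
    obtain as bs where split: "xs = as @ u # bs" using uv(1) by (meson split_list)
    let ?ys = "as @ u # v # u # bs"
    have "successively R ?ys"
      using xs(3) uv(4) assms(1) unfolding split
      by (auto simp: successively_append_iff successively_Cons dest: sympD)
    moreover have "hd ?ys = p" using xs(2) unfolding split by (cases as) auto
    moreover have "set ?ys = insert v (set xs)" unfolding split by auto
    ultimately show ?case
      using xs uv unfolding split by (intro exI[of _ ?ys]) auto
  qed
  moreover have "0 < card S" using assms(2,4) by (auto simp: card_gt_0_iff)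
  ultimately obtain xs where "xs \<noteq> []" "hd xs = p" "successively R xs" "set xs \<subseteq> S"
    "card (set xs) = card S" "length xs < 2 * card S" by blast
  with assms(2) show ?thesis by (metis card_subset_eq)
qed

definition walks_from :: "('a \<Rightarrow> 'a \<Rightarrow> bool) \<Rightarrow> 'a \<Rightarrow> nat \<Rightarrow> 'a list set" where
  "walks_from R p m = {xs. length xs = Suc m \<and> hd xs = p \<and> successively R xs}"

lemma card_walks_from_le:
  assumes "\<And>p. finite {q. R p q}" "\<And>p. card {q. R p q} \<le> D"
  shows "finite (walks_from R p m) \<and> card (walks_from R p m) \<le> D ^ m"
proof (induction m arbitrary: p)
  case 0
  have "walks_from R p 0 = {[p]}" by (auto simp: walks_from_def length_Suc_conv)
  then show ?case by simp
next
  case (Suc m)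
  have eq: "walks_from R p (Suc m) \<subseteq> (\<Union>q\<in>{q. R p q}. (#) p ` walks_from R q m)"
    by (auto simp: walks_from_def length_Suc_conv image_iff)
  have "card (\<Union>q\<in>{q. R p q}. (#) p ` walks_from R q m)
      \<le> (\<Sum>q\<in>{q. R p q}. card ((#) p ` walks_from R q m))"
    using assms(1) by (rule card_UN_le)
  also have "\<dots> \<le> (\<Sum>q\<in>{q. R p q}. D ^ m)"
    using Suc by (intro sum_mono) (meson card_image_le le_trans)
  also have "\<dots> \<le> D * D ^ m" using assms(2)[of p] by simp
  finally have "card (\<Union>q\<in>{q. R p q}. (#) p ` walks_from R q m) \<le> D ^ Suc m" by simp
  moreover have "finite (\<Union>q\<in>{q. R p q}. (#) p ` walks_from R q m)"
    using assms(1) Suc by auto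
  ultimately show ?case using eq by (meson card_mono finite_subset le_trans)
qed

section \<open>The space-time graph\<close>

text \<open>
  Besides the steps back and forth in time, the graph has edges between vertices at distance two at
  equal times. They join consecutive zeros of a path in the tree, where the vertex between them
  lives at the neighbouring times.
\<close>
definition st_adj :: "'v set set \<Rightarrow> 'v \<times> nat \<Rightarrow> 'v \<times> nat \<Rightarrow> bool" where
  "st_adj E p q \<longleftrightarrow>
     snd p = snd q \<and> (\<exists>y. adj E (fst p) y \<and> adj E y (fst q)) \<or>
     (snd p = Suc (snd q) \<or> snd q = Suc (snd p)) \<and> adj E (fst p) (fst q)"

lemma adj_sym: "adj E x y \<Longrightarrow> adj E y x"
  by (simp add: adj_def insert_commute)

lemma symp_st_adj: "symp (st_adj E)"
  unfolding symp_def st_adj_def using adj_sym by metis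

lemma st_adj_down: "adj E x y \<Longrightarrow> st_adj E (x, Suc s) (y, s)"
  by (simp add: st_adj_def)

lemma in_nbrs_iff: "y \<in> nbrs E x \<longleftrightarrow> adj E x y"
  unfolding nbrs_def using adj_sym by fastforce

locale bounded_graph =
  fixes V :: "'v set" and E :: "'v set set"
  assumes simple: "simple_graph V E" and bounded: "bounded_degree V E"
begin

lemma adj_in_V: "adj E x y \<Longrightarrow> x \<in> V \<and> y \<in> V"
  using simple by (auto simp: simple_graph_def adj_def)

lemma adj_irrefl: "\<not> adj E x x"
  using simple by (auto simp: simple_graph_def adj_def)

lemma nbrs_subset_V: "nbrs E x \<subseteq> V"
  using adj_in_V by (auto simp: nbrs_def)

lemma finite_nbrs [simp]: "finite (nbrs E x)"
proof (cases "x \<in> V")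
  case False
  then have "nbrs E x = {}" using adj_in_V by (auto simp: nbrs_def)
  then show ?thesis by simp
qed (use bounded in \<open>auto simp: bounded_degree_def\<close>)

lemma deg_le_max_degree: "deg E x \<le> max_degree V E"
proof (cases "x \<in> V")
  case True
  then show ?thesis using bounded by (auto simp: bounded_degree_def max_degree_def intro: cSUP_upper)
next
  case False
  then have "nbrs E x = {}" using adj_in_V by (auto simp: nbrs_def)
  then show ?thesis by (simp add: deg_def)
qed

lemma finite_card_st_adj:
  "finite {q. st_adj E p q} \<and> card {q. st_adj E p q} \<le> max_degree V E ^ 2 + 2 * max_degree V E"
proof -
  obtain x t where p: "p = (x, t)" by force
  let ?N = "nbrs E x" and ?D = "max_degree V E"
  let ?N2 = "\<Union>y\<in>?N. nbrs E y"
  have sub: "{q. st_adj E p q} \<subseteq> ?N2 \<times> {t} \<union> ?N \<times> {t - 1, Suc t}"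
    by (auto simp: p st_adj_def in_nbrs_iff)
  have "card ?N2 \<le> (\<Sum>y\<in>?N. card (nbrs E y))" by (rule card_UN_le) simp
  also have "\<dots> \<le> (\<Sum>y\<in>?N. ?D)"
    using deg_le_max_degree by (intro sum_mono) (simp add: deg_def)
  also have "\<dots> \<le> ?D * ?D" using deg_le_max_degree[of x] by (simp add: deg_def)
  finally have N2: "card ?N2 \<le> ?D * ?D" .
  have N: "card ?N \<le> ?D" using deg_le_max_degree[of x] by (simp add: deg_def)
  have "card (?N2 \<times> {t} \<union> ?N \<times> {t - 1, Suc t}) \<le> card (?N2 \<times> {t}) + card (?N \<times> {t - 1, Suc t})"
    by (rule card_Un_le)
  also have "\<dots> \<le> ?D * ?D + ?D * 2"
    using N N2 by (intro add_mono) (auto simp: card_cartesian_product)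
  finally have "card (?N2 \<times> {t} \<union> ?N \<times> {t - 1, Suc t}) \<le> ?D ^ 2 + 2 * ?D"
    by (simp add: power2_eq_square)
  moreover have "finite (?N2 \<times> {t} \<union> ?N \<times> {t - 1, Suc t})" by auto
  ultimately show ?thesis using sub by (meson card_mono finite_subset le_trans)
qed

end

text \<open>
  The certificate for a zero at a space-time point \<open>p\<close>: a connected set around \<open>p\<close> in which the
  points of \<open>F\<close> (where the noise erases) have density at least \<open>1/k\<close>.
\<close>
definition error_cluster ::
  "'v set set \<Rightarrow> nat \<Rightarrow> ('v \<times> nat) set \<Rightarrow> 'v \<times> nat \<Rightarrow> ('v \<times> nat) set \<Rightarrow> bool" where
  "error_cluster E k F p S \<longleftrightarrow>
     finite S \<and> p \<in> S \<and> connected_in (st_adj E) S \<and> card S \<le> k * card (S \<inter> F)"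

section \<open>Graphs with large edge expansion\<close>

context bounded_graph
begin

definition ordered_edges :: "'v set \<Rightarrow> 'v set \<Rightarrow> ('v \<times> 'v) set" where
  "ordered_edges X Y = {(x, y). x \<in> X \<and> y \<in> Y \<and> adj E x y}"

lemma ordered_edges_eq_Sigma: "ordered_edges X Y = (SIGMA x:X. nbrs E x \<inter> Y)"
  by (auto simp: ordered_edges_def in_nbrs_iff)

lemma finite_ordered_edges [simp]: "finite X \<Longrightarrow> finite (ordered_edges X Y)"
  by (simp add: ordered_edges_eq_Sigma)

lemma card_ordered_edges: "finite X \<Longrightarrow> card (ordered_edges X Y) = (\<Sum>x\<in>X. card (nbrs E x \<inter> Y))"
  by (simp add: ordered_edges_eq_Sigma card_SigmaI)

lemma edge_boundary_subset: "edge_boundary E K \<subseteq> (\<lambda>(x, y). {x, y}) ` ordered_edges K (- K)"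
proof
  fix e assume e: "e \<in> edge_boundary E K"
  then obtain x where x: "e \<inter> K = {x}" by (auto simp: edge_boundary_def card_1_singleton_iff)
  from e have "card e = 2" using simple by (auto simp: edge_boundary_def simple_graph_def)
  then obtain a b where ab: "e = {a, b}" "a \<noteq> b" by (auto simp: card_2_iff)
  have "x \<in> e" using x by blast
  then obtain y where y: "e = {x, y}" "x \<noteq> y" using ab by blast
  have "x \<in> K" "y \<notin> K" using x y(2) unfolding y(1) by auto
  then have "(x, y) \<in> ordered_edges K (- K)"
    using e y(1) by (simp add: ordered_edges_def edge_boundary_def adj_def)
  then show "e \<in> (\<lambda>(x, y). {x, y}) ` ordered_edges K (- K)"
    by (rule rev_image_eqI) (simp add: y(1))
qed

lemma finite_edge_boundary: "finite K \<Longrightarrow> finite (edge_boundary E K)"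
  by (rule finite_subset[OF edge_boundary_subset]) simp

lemma card_edge_boundary_le: "finite K \<Longrightarrow> card (edge_boundary E K) \<le> card (ordered_edges K (- K))"
  by (rule surj_card_le[OF finite_ordered_edges edge_boundary_subset])

lemma Phi_E_le:
  assumes "finite K" "K \<subseteq> V" "K \<noteq> {}"
  shows "Phi_E V E \<le> card (edge_boundary E K) / card K"
  unfolding Phi_E_def using assms by (intro cINF_lower) (auto intro!: bdd_belowI[of _ 0])

lemma Phi_E_mult_card_le:
  assumes "finite K" "K \<subseteq> V"
  shows "Phi_E V E * card K \<le> card (ordered_edges K (- K))"
proof (cases "K = {}")
  case False
  then have "Phi_E V E * card K \<le> card (edge_boundary E K)"
    using Phi_E_le[OF assms False] assms by (simp add: field_simps card_gt_0_iff)
  also have "\<dots> \<le> card (ordered_edges K (- K))" using card_edge_boundary_le[OF assms(1)] by simp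
  finally show ?thesis .
qed simp

lemma Phi_E_le_deg: "x \<in> V \<Longrightarrow> Phi_E V E \<le> deg E x"
  using Phi_E_mult_card_le[of "{x}"] card_mono[of "nbrs E x" "nbrs E x \<inter> - {x}"]
  by (simp add: card_ordered_edges deg_def)

text \<open>
  \<open>K\<close> and \<open>A\<close> are read as sets of vertices on the two sides of the bipartite double cover of the
  graph; the right-hand side is the boundary of their union there. It is at least the sum of the
  boundaries of \<open>K \<inter> A\<close> and \<open>K \<union> A\<close> in the graph itself, so that passing to the double cover
  does not spoil the expansion.
\<close>
lemma expansion_double_cover:
  assumes "finite K" "K \<subseteq> V" "finite A" "A \<subseteq> V"
  shows "Phi_E V E * (card K + card A) \<le> card (ordered_edges K (- A)) + card (ordered_edges A (- K))"
proof -
  let ?I = "ordered_edges (K \<inter> A) (- (K \<inter> A))" and ?U = "ordered_edges (K \<union> A) (- (K \<union> A))"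
  let ?P = "ordered_edges K (- A)" and ?Q = "ordered_edges A (- K)"
  have "?I \<union> ?U \<subseteq> ?P \<union> ?Q" "?I \<inter> ?U \<subseteq> ?P \<inter> ?Q" by (auto simp: ordered_edges_def)
  then have "card (?I \<union> ?U) + card (?I \<inter> ?U) \<le> card (?P \<union> ?Q) + card (?P \<inter> ?Q)"
    using assms by (intro add_mono card_mono) auto
  then have "card ?I + card ?U \<le> card ?P + card ?Q"
    using card_Un_Int[of ?I ?U] card_Un_Int[of ?P ?Q] assms by simp
  then have "real (card ?I) + card ?U \<le> card ?P + card ?Q" by linarith
  moreover have "Phi_E V E * card (K \<inter> A) \<le> card ?I" "Phi_E V E * card (K \<union> A) \<le> card ?U"
    using assms by (intro Phi_E_mult_card_le; auto)+
  moreover have "real (card K) + card A = card (K \<inter> A) + card (K \<union> A)"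
    using card_Un_Int[OF assms(1,3)] by linarith
  ultimately show ?thesis by (simp add: algebra_simps)
qed

text \<open>
  The edges between \<open>K\<close> and \<open>A\<close> are as many when counted from \<open>K\<close> as from \<open>A\<close>. This expresses the
  number of edges leaving \<open>A\<close> towards the complement of \<open>K\<close>, which the dynamics do not control, by
  the number of those leaving \<open>K\<close> towards the complement of \<open>A\<close>, which they do.
\<close>
lemma card_ordered_edges_swap:
  assumes "finite K" "finite A"
  shows "card (ordered_edges A (- K)) + (\<Sum>x\<in>K. deg E x)
       = card (ordered_edges K (- A)) + (\<Sum>x\<in>A. deg E x)"
proof -
  have split: "(\<Sum>x\<in>X. deg E x) = card (ordered_edges X Y) + card (ordered_edges X (- Y))"
    if "finite X" for X Y
  proof -
    have "card (nbrs E x) = card (nbrs E x \<inter> Y) + card (nbrs E x \<inter> - Y)" for x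
      using card_Int_Diff[of "nbrs E x" Y] by (simp add: Diff_eq)
    then show ?thesis using that by (simp add: card_ordered_edges deg_def sum.distrib)
  qed
  have "ordered_edges K A = prod.swap ` ordered_edges A K"
    by (auto simp: ordered_edges_def intro: adj_sym)
  then have "card (ordered_edges K A) = card (ordered_edges A K)"
    by (simp add: card_image)
  then show ?thesis using split[OF assms(1), of A] split[OF assms(2), of K] by simp
qed

text \<open>
  One step back in time: \<open>K\<close> are zeros not caused by the noise, \<open>A\<close> their zero neighbours one time
  unit earlier. The total weight \<open>deg - \<Phi>\<close> grows by a definite amount per element of \<open>K\<close>.
\<close>
lemma backward_growth:
  assumes "finite K" "K \<subseteq> V" "finite A" "A \<subseteq> V"
    and few: "\<And>x. x \<in> K \<Longrightarrow> card (nbrs E x - A) < j"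
  shows "(\<Sum>x\<in>K. deg E x - Phi_E V E) + 2 * (Phi_E V E + 1 - j) * card K
       \<le> (\<Sum>x\<in>A. deg E x - Phi_E V E)"
proof -
  have few_edges: "card (ordered_edges K (- A)) \<le> (\<Sum>x\<in>K. j - 1)"
    unfolding card_ordered_edges[OF assms(1)]
    using few by (intro sum_mono) (fastforce simp: Diff_eq)
  then have "real (card (ordered_edges K (- A))) \<le> (real j - 1) * card K"
  proof (cases "K = {}")
    case False
    then have "1 \<le> j" using few by fastforce
    then have "real ((j - 1) * card K) = (real j - 1) * card K" by (simp add: of_nat_diff)
    moreover have "real (card (ordered_edges K (- A))) \<le> real ((j - 1) * card K)"
      using few_edges by (simp only: of_nat_le_iff sum_constant of_nat_id mult.commute)
    ultimately show ?thesis by linarith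
  qed (simp add: ordered_edges_def)
  moreover have "real (card (ordered_edges A (- K))) + (\<Sum>x\<in>K. real (deg E x))
       = card (ordered_edges K (- A)) + (\<Sum>x\<in>A. real (deg E x))"
    using card_ordered_edges_swap[OF assms(1,3)] by (metis of_nat_add of_nat_sum)
  moreover note expansion_double_cover[OF assms(1-4)]
  ultimately show ?thesis by (simp add: sum_subtractf algebra_simps)
qed

text \<open>
  The set \<open>S\<close> consists of \<open>A\<close> and of all zeros reached from it by going back in time from points
  without noise. A noise point is not followed further; its own weight is at most
  \<open>max_degree V E - Phi_E V E\<close>, which the coefficient of \<open>card (S \<inter> F)\<close> pays for. All other weight is
  passed on, with gain, by \<open>backward_growth\<close>.
\<close>
lemma zeros_have_ancestors:
  fixes Z :: "nat \<Rightarrow> 'v set" and F :: "('v \<times> nat) set" and j :: nat and \<gamma> :: real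
  defines "\<gamma> \<equiv> 2 * (Phi_E V E + 1 - j)"
  assumes gamma: "0 < \<gamma>"
    and Z0: "Z 0 = {}" and ZV: "\<And>s. Z s \<subseteq> V"
    and step: "\<And>x s. x \<in> Z (Suc s) \<Longrightarrow> (x, Suc s) \<notin> F \<Longrightarrow> card (nbrs E x - Z s) < j"
    and A: "finite A" "A \<subseteq> Z s"
  shows "\<exists>S. finite S \<and> (\<forall>x r. (x, r) \<in> S \<longrightarrow> x \<in> Z r \<and> r \<le> s) \<and> (\<forall>x. (x, s) \<in> S \<longleftrightarrow> x \<in> A)
     \<and> (\<forall>q\<in>S. \<exists>x\<in>A. (\<lambda>a b. a \<in> S \<and> b \<in> S \<and> st_adj E a b)\<^sup>*\<^sup>* (x, s) q)
     \<and> \<gamma> * card S + (\<Sum>x\<in>A. deg E x - Phi_E V E) \<le> (\<gamma> + max_degree V E - Phi_E V E) * card (S \<inter> F)"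
  using A
proof (induction s arbitrary: A)
  case 0
  then have "A = {}" using Z0 by simp
  then show ?case by (intro exI[of _ "{}"]) auto
next
  case (Suc s)
  define B where "B = {x \<in> A. (x, Suc s) \<in> F}"
  define K where "K = A - B"
  define A' where "A' = (\<Union>x\<in>K. nbrs E x \<inter> Z s)"
  have fin: "finite B" "finite K" "finite A'" using Suc.prems by (auto simp: B_def K_def A'_def)
  have sub: "A' \<subseteq> Z s" by (auto simp: A'_def)
  obtain S' where S': "finite S'" "\<And>x r. (x, r) \<in> S' \<Longrightarrow> x \<in> Z r \<and> r \<le> s"
    "\<And>x. (x, s) \<in> S' \<longleftrightarrow> x \<in> A'"
    "\<And>q. q \<in> S' \<Longrightarrow> \<exists>x\<in>A'. (\<lambda>a b. a \<in> S' \<and> b \<in> S' \<and> st_adj E a b)\<^sup>*\<^sup>* (x, s) q"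
    "\<gamma> * card S' + (\<Sum>x\<in>A'. deg E x - Phi_E V E) \<le> (\<gamma> + max_degree V E - Phi_E V E) * card (S' \<inter> F)"
    using Suc.IH[OF fin(3) sub] by blast
  \<comment> \<open>neighbours of \<open>K\<close> outside \<open>A'\<close> are ones, and there are fewer than \<open>j\<close> of them\<close>
  have growth: "(\<Sum>x\<in>K. deg E x - Phi_E V E) + \<gamma> * card K \<le> (\<Sum>x\<in>A'. deg E x - Phi_E V E)"
    unfolding \<gamma>_def
  proof (rule backward_growth)
    fix x assume x: "x \<in> K"
    then have "card (nbrs E x - Z s) < j" using Suc.prems by (intro step) (auto simp: K_def B_def)
    moreover have "nbrs E x - A' \<subseteq> nbrs E x - Z s" using x by (auto simp: A'_def)
    ultimately show "card (nbrs E x - A') < j"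
      by (meson card_mono finite_Diff finite_nbrs le_less_trans)
  qed (use fin Suc.prems ZV sub in \<open>auto simp: K_def\<close>)
  define S where "S = A \<times> {Suc s} \<union> S'"
  let ?R = "\<lambda>S a b. a \<in> S \<and> b \<in> S \<and> st_adj E a b"
  have disj: "A \<times> {Suc s} \<inter> S' = {}" using S'(2) by fastforce
  then have card_S: "card S = card A + card S'"
    using Suc.prems(1) S'(1) by (simp add: S_def card_Un_disjoint card_cartesian_product)
  have "S \<inter> F = B \<times> {Suc s} \<union> (S' \<inter> F)" "B \<times> {Suc s} \<inter> (S' \<inter> F) = {}"
    using disj by (auto simp: S_def B_def)
  then have card_SF: "card (S \<inter> F) = card B + card (S' \<inter> F)"
    using fin S'(1) by (simp add: card_Un_disjoint card_cartesian_product)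
  have AB: "A = B \<union> K" "B \<inter> K = {}" by (auto simp: B_def K_def)
  have "(\<Sum>x\<in>B. deg E x - Phi_E V E) \<le> (\<Sum>x\<in>B. max_degree V E - Phi_E V E)"
    using deg_le_max_degree by (intro sum_mono) simp
  then have wB: "(\<Sum>x\<in>B. deg E x - Phi_E V E) \<le> card B * (max_degree V E - Phi_E V E)" by simp
  have wA: "(\<Sum>x\<in>A. deg E x - Phi_E V E)
      = (\<Sum>x\<in>B. deg E x - Phi_E V E) + (\<Sum>x\<in>K. deg E x - Phi_E V E)"
    unfolding AB(1) using fin AB(2) by (intro sum.union_disjoint) auto
  have cA: "card A = card B + card K" using AB fin by (metis card_Un_disjoint)
  have bound: "\<gamma> * card S + (\<Sum>x\<in>A. deg E x - Phi_E V E)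
      \<le> (\<gamma> + max_degree V E - Phi_E V E) * card (S \<inter> F)"
    using S'(5) growth wB unfolding wA card_S card_SF cA by (simp add: algebra_simps)
  have lift: "(?R S)\<^sup>*\<^sup>* a b" if "(?R S')\<^sup>*\<^sup>* a b" for a b
    using that by (rule rtranclp_mono[THEN predicate2D, rotated]) (auto simp: S_def)
  have "\<exists>x\<in>A. (?R S)\<^sup>*\<^sup>* (x, Suc s) q" if q: "q \<in> S" for q
  proof (cases "q \<in> S'")
    case True
    then obtain y where y: "y \<in> A'" "(?R S')\<^sup>*\<^sup>* (y, s) q" using S'(4) by blast
    then obtain x where x: "x \<in> K" "adj E x y" by (auto simp: A'_def in_nbrs_iff)
    then have "?R S (x, Suc s) (y, s)" using y(1) S'(3) by (auto simp: S_def K_def st_adj_down)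
    then have "(?R S)\<^sup>*\<^sup>* (x, Suc s) q" using lift[OF y(2)] by (rule converse_rtranclp_into_rtranclp)
    then show ?thesis using x(1) unfolding K_def by blast
  next
    case False
    then show ?thesis using q by (auto simp: S_def)
  qed
  note reach = this
  have finS: "finite S" using S'(1) Suc.prems by (simp add: S_def)
  have zeros: "x \<in> Z r \<and> r \<le> Suc s" if "(x, r) \<in> S" for x r
    using that S'(2)[of x r] Suc.prems by (auto simp: S_def)
  have top: "(x, Suc s) \<in> S \<longleftrightarrow> x \<in> A" for x using S'(2) by (fastforce simp: S_def)
  show ?case
    using finS zeros top reach bound by (intro exI[of _ S] conjI allI ballI impI) simp_all
qed

proposition expanding_error_cluster:
  assumes j: "j < Phi_E V E + 1"
  shows "\<exists>k. \<forall>Z F. Z 0 = {} \<longrightarrow> (\<forall>s. Z s \<subseteq> V)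
     \<longrightarrow> (\<forall>x s. x \<in> Z (Suc s) \<longrightarrow> (x, Suc s) \<notin> F \<longrightarrow> card (nbrs E x - Z s) < j)
     \<longrightarrow> (\<forall>t. \<forall>x\<in>Z t. \<exists>S. error_cluster E k F (x, t) S \<and> (\<forall>y s. (y, s) \<in> S \<longrightarrow> y \<in> Z s \<and> s \<le> t))"
proof -
  define \<gamma> :: real where "\<gamma> = 2 * (Phi_E V E + 1 - j)"
  have \<gamma>: "0 < \<gamma>" using j by (simp add: \<gamma>_def)
  define C where "C = \<gamma> + max_degree V E - Phi_E V E"
  define k where "k = nat \<lceil>C / \<gamma>\<rceil>"
  have "\<exists>S. error_cluster E k F (x, t) S \<and> (\<forall>y s. (y, s) \<in> S \<longrightarrow> y \<in> Z s \<and> s \<le> t)"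
    if Z0: "Z 0 = {}" and ZV: "\<And>s. Z s \<subseteq> V"
      and step: "\<And>x s. x \<in> Z (Suc s) \<Longrightarrow> (x, Suc s) \<notin> F \<Longrightarrow> card (nbrs E x - Z s) < j"
      and x: "x \<in> Z t" for Z F t x
  proof -
    obtain S where S: "finite S" "\<forall>y s. (y, s) \<in> S \<longrightarrow> y \<in> Z s \<and> s \<le> t"
      "\<forall>y. (y, t) \<in> S \<longleftrightarrow> y \<in> {x}"
      "\<forall>q\<in>S. \<exists>y\<in>{x}. (\<lambda>a b. a \<in> S \<and> b \<in> S \<and> st_adj E a b)\<^sup>*\<^sup>* (y, t) q"
      "\<gamma> * card S + (\<Sum>y\<in>{x}. deg E y - Phi_E V E) \<le> C * card (S \<inter> F)"
      using zeros_have_ancestors[where j = j and Z = Z and F = F and A = "{x}" and s = t,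
          folded \<gamma>_def, folded C_def, OF \<gamma> Z0 ZV step] x
      by blast
    have "Phi_E V E \<le> deg E x" using Phi_E_le_deg x ZV by blast
    then have "\<gamma> * card S \<le> C * card (S \<inter> F)" using S(5) by simp
    then have "real (card S) \<le> C / \<gamma> * card (S \<inter> F)" using \<gamma> by (simp add: field_simps)
    also have "\<dots> \<le> real k * card (S \<inter> F)"
      unfolding k_def by (intro mult_right_mono) (simp_all add: real_nat_ceiling_ge)
    finally have "card S \<le> k * card (S \<inter> F)" by (simp flip: of_nat_mult)
    moreover have "connected_in (st_adj E) S"
      using S(4) by (intro connected_in_from_root[OF symp_st_adj]) auto
    ultimately show ?thesis using S(1-3) unfolding error_cluster_def by blast
  qed
  then show ?thesis by blast
qed

end

section \<open>Trees at the critical threshold\<close>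

text \<open>
  Non-backtracking walks with \<open>n\<close> steps. In a tree these are the geodesics; being indexed by
  numbers, they are easily restricted to segments.
\<close>
definition nb_walk :: "'v set set \<Rightarrow> (nat \<Rightarrow> 'v) \<Rightarrow> nat \<Rightarrow> bool" where
  "nb_walk E x n \<longleftrightarrow> (\<forall>i<n. adj E (x i) (x (Suc i))) \<and> (\<forall>i. i + 2 \<le> n \<longrightarrow> x i \<noteq> x (i + 2))"

lemma nb_walk_shift: "nb_walk E x n \<Longrightarrow> m + d \<le> n \<Longrightarrow> nb_walk E (\<lambda>i. x (i + d)) m"
  unfolding nb_walk_def
proof (intro conjI allI impI; elim conjE)
  fix i assume "\<forall>i. i + 2 \<le> n \<longrightarrow> x i \<noteq> x (i + 2)" "m + d \<le> n" "i + 2 \<le> m"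
  then show "x (i + d) \<noteq> x (i + 2 + d)" by (metis add.assoc add.commute add_le_mono1 le_trans)
qed auto

text \<open>
  A shortest segment between two visits of the same vertex would be a cycle.
\<close>
lemma (in bounded_graph) nb_walk_distinct:
  assumes acyclic: "\<not> has_cycle E" and walk: "nb_walk E x n"
  shows "i < j \<Longrightarrow> j \<le> n \<Longrightarrow> x i \<noteq> x j"
proof (induction "j - i" arbitrary: i j rule: less_induct)
  case less
  have adj: "adj E (x a) (x (Suc a))" if "a < n" for a using walk that by (simp add: nb_walk_def)
  show ?case
  proof
    assume eq: "x i = x j"
    have "j \<noteq> Suc i" using adj[of i] eq less.prems adj_irrefl by auto
    moreover have "j \<noteq> i + 2" using walk eq less.prems by (auto simp: nb_walk_def)
    ultimately have len: "3 \<le> j - i" using less.prems by linarith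
    let ?xs = "map x [i..<j]"
    have "inj_on x {i..<j}"
    proof (rule linorder_inj_onI)
      fix a b assume "a < b" "a \<in> {i..<j}" "b \<in> {i..<j}"
      then show "x a \<noteq> x b" using less.prems by (intro less.hyps) auto
    qed auto
    then have "distinct ?xs" by (simp add: distinct_map)
    moreover have "successively (adj E) (map x [i..<b])" if "b \<le> j" for b
      using that
    proof (induction b)
      case (Suc b)
      show ?case
      proof (cases "i < b")
        case True
        then have "last (map x [i..<b]) = x (b - 1)" by (simp add: last_map)
        moreover have "adj E (x (b - 1)) (x b)" using adj[of "b - 1"] True Suc.prems less.prems by auto
        ultimately show ?thesis using Suc True by (auto simp: successively_append_iff)
      qed (use Suc in \<open>cases "i = b"; auto\<close>)
    qed simp
    then have "successively (adj E) ?xs" by simp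
    moreover have "adj E (last ?xs) (hd ?xs)"
      using adj[of "j - 1"] eq less.prems by (simp add: last_map hd_map)
    ultimately have "has_cycle E" unfolding has_cycle_def using len by (intro exI[of _ ?xs]) simp
    with acyclic show False ..
  qed
qed

text \<open>
  Two vertices at even distance are separated by a set \<open>Z\<close> of zeros if a one lies on the geodesic
  between them, at even distance from both. Parity matters because a vertex interacts with
  its neighbours at adjacent times only: at one fixed time, the vertices of the opposite parity
  belong to an independent part of the space-time picture.
\<close>
definition separated :: "'v set set \<Rightarrow> 'v set \<Rightarrow> 'v \<Rightarrow> 'v \<Rightarrow> bool" where
  "separated E Z p q \<longleftrightarrow> (\<exists>x n c. nb_walk E x n \<and> x 0 = p \<and> x n = q \<and> even n \<and> even c
     \<and> 0 < c \<and> c < n \<and> x c \<notin> Z)"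

text \<open>
  Replacing an end by one of its neighbours either lengthens or shortens the geodesic by one step,
  so the parity of its length and of the positions counted from that end changes.
\<close>
lemma nb_walk_change_start:
  assumes "nb_walk E x n" "adj E p (x 0)" "0 < c" "c \<le> n"
  shows "\<exists>y n' c'. nb_walk E y n' \<and> y 0 = p \<and> y n' = x n \<and> y c' = x c
           \<and> c' \<le> n' \<and> (even n' \<longleftrightarrow> odd n) \<and> (even c' \<longleftrightarrow> odd c)"
proof (cases "p = x 1")
  case True
  have "nb_walk E (\<lambda>i. x (i + 1)) (n - 1)"
    using assms by (intro nb_walk_shift[OF assms(1)]) auto
  with True show ?thesis
    using assms(3,4) by (intro exI[of _ "\<lambda>i. x (i + 1)"] exI[of _ "n - 1"] exI[of _ "c - 1"]) auto
next
  case False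
  have "nb_walk E (case_nat p x) (Suc n)"
    using assms(1,2) False by (auto simp: nb_walk_def split: nat.splits)
  then show ?thesis
    using assms(3,4) by (intro exI[of _ "case_nat p x"] exI[of _ "Suc n"] exI[of _ "Suc c"]) auto
qed

lemma nb_walk_change_end:
  assumes "nb_walk E x n" "adj E q (x n)" "c < n"
  shows "\<exists>y n'. nb_walk E y n' \<and> y 0 = x 0 \<and> y n' = q \<and> y c = x c
           \<and> c \<le> n' \<and> (even n' \<longleftrightarrow> odd n)"
proof (cases "q = x (n - 1)")
  case True
  have "nb_walk E x (n - 1)" using assms(1) by (auto simp: nb_walk_def)
  with True show ?thesis using assms(3) by (intro exI[of _ x] exI[of _ "n - 1"]) auto
next
  case False
  have "nb_walk E (x(Suc n := q)) (Suc n)"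
    using assms False adj_sym[OF assms(2)] by (auto simp: nb_walk_def le_Suc_eq less_Suc_eq)
  then show ?thesis
    using assms(3) by (intro exI[of _ "x(Suc n := q)"] exI[of _ "Suc n"]) auto
qed

lemma separated_one_step_back:
  assumes "nb_walk E x n" "even n" "odd c" "c < n" "x c \<notin> Z"
    and p: "adj E p (x 0)" "p \<in> Z" and q: "adj E q (x n)" "q \<in> Z"
  shows "separated E Z p q"
proof -
  have "0 < c" using assms(3) by (cases c) auto
  then obtain y n' c' where y: "nb_walk E y n'" "y 0 = p" "y n' = x n" "y c' = x c" "c' \<le> n'"
    "odd n'" "even c'"
    using nb_walk_change_start[OF assms(1) p(1), of c] assms(2-4) by auto
  then have "c' < n'" by (metis le_neq_implies_less)
  then obtain z n'' where z: "nb_walk E z n''" "z 0 = p" "z n'' = q" "z c' = x c" "c' \<le> n''" "even n''"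
    using nb_walk_change_end[OF y(1), of q c'] y q(1) by auto
  moreover have "c' \<noteq> 0" "c' \<noteq> n''" using z assms(5) p(2) q(2) by metis+
  ultimately show ?thesis
    unfolding separated_def using y(7) assms(5)
    by (intro exI[of _ z] exI[of _ n''] exI[of _ c']) auto
qed

text \<open>
  The past of a zero at time \<open>s\<close>: chains of zeros back in time that only pass through points with
  at least two zero neighbours at the time before. A zero without two such neighbours is noise and has
  no past.
\<close>
inductive descendant :: "'v set set \<Rightarrow> (nat \<Rightarrow> 'v set) \<Rightarrow> 'v \<Rightarrow> nat \<Rightarrow> 'v \<Rightarrow> nat \<Rightarrow> bool"
  for E Z where
  self: "descendant E Z u s u s"
| child: "descendant E Z w s v r \<Longrightarrow> 2 \<le> card (nbrs E u \<inter> Z s) \<Longrightarrow> w \<in> nbrs E u \<inter> Z s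
    \<Longrightarrow> descendant E Z u (Suc s) v r"

lemma descendant_le: "descendant E Z u s v r \<Longrightarrow> r \<le> s"
  by (induction rule: descendant.induct) auto

lemma descendant_same_time: "descendant E Z u s v s \<Longrightarrow> v = u"
  by (erule descendant.cases) (auto dest: descendant_le)

lemma descendant_earlier:
  assumes "descendant E Z u (Suc s) v r" "r \<le> s"
  shows "2 \<le> card (nbrs E u \<inter> Z s) \<and> (\<exists>w\<in>nbrs E u \<inter> Z s. descendant E Z w s v r)"
  using assms by (cases rule: descendant.cases) auto

text \<open>
  The zeros of the consensus process on the \<open>d\<close>-regular tree with threshold \<open>d - 1\<close>, given the
  space-time points \<open>F\<close> of the noise: two zero neighbours make a zero, and without noise nothing
  else does.
\<close>
locale tree_zeros = bounded_graph +
  fixes Z :: "nat \<Rightarrow> 'a set" and F :: "('a \<times> nat) set"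
  assumes acyclic: "\<not> has_cycle E"
    and Z0: "Z 0 = {}"
    and spontaneous: "\<And>x s. x \<in> Z (Suc s) \<Longrightarrow> (x, Suc s) \<notin> F \<Longrightarrow> 2 \<le> card (nbrs E x \<inter> Z s)"
    and blocked: "\<And>x s. x \<in> V \<Longrightarrow> x \<notin> Z (Suc s) \<Longrightarrow> card (nbrs E x \<inter> Z s) \<le> 1"
begin

lemma two_nbrs_card:
  assumes "adj E v a" "adj E v b" "a \<noteq> b" "a \<in> A" "b \<in> A"
  shows "2 \<le> card (nbrs E v \<inter> A)"
proof -
  have "card {a, b} \<le> card (nbrs E v \<inter> A)"
    using assms by (intro card_mono) (auto simp: in_nbrs_iff)
  with assms(3) show ?thesis by simp
qed

text \<open>
  Separation is inherited by the past: the separating one has at most one zero neighbour at the time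
  before, and two neighbours on the geodesic.
\<close>
lemma separated_nbrs:
  assumes "separated E (Z (Suc s)) p q" "p' \<in> nbrs E p \<inter> Z s" "q' \<in> nbrs E q \<inter> Z s"
  shows "separated E (Z s) p' q'"
proof -
  obtain x n c where x: "nb_walk E x n" "x 0 = p" "x n = q" "even n" "even c" "0 < c" "c < n"
    "x c \<notin> Z (Suc s)" using assms(1) by (auto simp: separated_def)
  have walk: "\<And>i. i < n \<Longrightarrow> adj E (x i) (x (Suc i))" "\<And>i. i + 2 \<le> n \<Longrightarrow> x i \<noteq> x (i + 2)"
    using x(1) by (simp_all add: nb_walk_def)
  have adj: "adj E (x (c - 1)) (x c)" "adj E (x c) (x (c + 1))" "x (c - 1) \<noteq> x (c + 1)"
    using walk(1)[of "c - 1"] walk(1)[of c] walk(2)[of "c - 1"] x(6,7) by auto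
  then have "\<not> 2 \<le> card (nbrs E (x c) \<inter> Z s)" using blocked[of "x c" s] adj_in_V[OF adj(2)] x(8) by simp
  then have "x (c - 1) \<notin> Z s \<or> x (c + 1) \<notin> Z s" using two_nbrs_card[OF adj_sym[OF adj(1)] adj(2,3)] by blast
  then obtain c' where "odd c'" "c' < n" "x c' \<notin> Z s"
  proof
    assume "x (c - 1) \<notin> Z s"
    moreover have "odd (c - 1)" using x(5,6) by simp
    ultimately show thesis using that[of "c - 1"] x(7) by simp
  next
    assume "x (c + 1) \<notin> Z s"
    moreover have "c + 1 \<noteq> n" using x(4,5) by auto
    ultimately show thesis using that[of "c + 1"] x(5,7) by simp
  qed
  moreover have "adj E p' (x 0)" "adj E q' (x n)"
    using assms(2,3) x(2,3) by (auto simp: in_nbrs_iff intro: adj_sym)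
  ultimately show ?thesis
    using separated_one_step_back[OF x(1,4)] assms(2,3) by blast
qed

lemma separated_neq: "separated E A p q \<Longrightarrow> p \<noteq> q"
proof -
  assume "separated E A p q"
  then obtain x n c where x: "nb_walk E x n" "x 0 = p" "x n = q" "0 < c" "c < n"
    unfolding separated_def by blast
  with nb_walk_distinct[OF acyclic x(1), of 0 n] show "p \<noteq> q" by simp
qed

lemma separated_descendants_neq:
  assumes "separated E (Z s) p q" "descendant E Z p s v r" "descendant E Z q s w r"
  shows "v \<noteq> w"
  using assms
proof (induction s arbitrary: p q)
  case (0 p q)
  then have "v = p" "w = q" by (auto elim: descendant.cases)
  with 0(1) show ?case by (auto dest: separated_neq)
next
  case (Suc s)
  show ?case
  proof (cases "r = Suc s")
    case True
    then have "v = p" "w = q" using Suc.prems(2,3) by (auto dest: descendant_same_time)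
    with Suc.prems(1) show ?thesis by (auto dest: separated_neq)
  next
    case False
    then have "r \<le> s" using descendant_le[OF Suc.prems(2)] by simp
    obtain p' q' where p': "p' \<in> nbrs E p \<inter> Z s" "descendant E Z p' s v r"
      and q': "q' \<in> nbrs E q \<inter> Z s" "descendant E Z q' s w r"
      using descendant_earlier[OF Suc.prems(2) \<open>r \<le> s\<close>] descendant_earlier[OF Suc.prems(3) \<open>r \<le> s\<close>]
      by blast
    show ?thesis
      using Suc.IH[OF separated_nbrs[OF Suc.prems(1) p'(1) q'(1)] p'(2) q'(2)] .
  qed
qed

text \<open>
  The zeros \<open>x 0, x 2, \<dots>, x (2 * m)\<close> form a path at time \<open>s\<close>. It is interrupted by those of them that
  have no two zero neighbours at time \<open>s - 1\<close>, which are noise, and by the ones among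
  \<open>x 1, x 3, \<dots>\<close> at time \<open>s - 1\<close>. Without interruption, \<open>x 1, x 3, \<dots>\<close>, together with a further zero
  neighbour at either end, form a path with one more zero at time \<open>s - 1\<close>. The two ends of
  the old path are added to the set of the new one, which the gain \<open>2\<close> in the term \<open>2 * (m + 1)\<close> pays
  for. A noise point costs one element and shortens the path by one zero, which its weight \<open>3\<close> pays for.
  The remaining cases reduce to these by splitting off the first uninterrupted part of
  the path; the sets of the two parts are disjoint because their pasts are separated. Keeping both
  ends of the path in the set is what makes the union of the parts connected.
\<close>
lemma tree_cluster:
  assumes "nb_walk E x (2 * m)" "\<And>i. i \<le> m \<Longrightarrow> x (2 * i) \<in> Z s"
  shows "\<exists>S. finite S \<and> connected_in (st_adj E) S \<and> (x 0, s) \<in> S \<and> (x (2 * m), s) \<in> S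
     \<and> (\<forall>v r. (v, r) \<in> S \<longrightarrow> v \<in> Z r \<and> (\<exists>i\<le>m. descendant E Z (x (2 * i)) s v r))
     \<and> card S + 2 * (m + 1) \<le> 3 * card (S \<inter> F)"
  using assms
proof (induction s arbitrary: x m)
  case 0
  then show ?case using Z0 by blast
next
  case (Suc s)
  note IH_time = Suc.IH
  let ?good = "\<lambda>u. 2 \<le> card (nbrs E u \<inter> Z s)"
  show ?case using Suc.prems
  proof (induction m arbitrary: x rule: less_induct)
    case (less m)
    note walk = less.prems(1) and zero = less.prems(2)
    have adjx: "adj E (x i) (x (Suc i))" if "i < 2 * m" for i using walk that by (simp add: nb_walk_def)
    have dist2: "st_adj E (x i, Suc s) (x (i + 2), Suc s)" if "i + 2 \<le> 2 * m" for i
      using adjx[of i] adjx[of "i + 1"] that by (auto simp: st_adj_def)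
    have rest: "\<exists>S. finite S \<and> connected_in (st_adj E) S \<and> (x (2 * d), Suc s) \<in> S
        \<and> (x (2 * m), Suc s) \<in> S
        \<and> (\<forall>v r. (v, r) \<in> S \<longrightarrow> v \<in> Z r
              \<and> (\<exists>i. d \<le> i \<and> i \<le> m \<and> descendant E Z (x (2 * i)) (Suc s) v r))
        \<and> card S + 2 * (m - d + 1) \<le> 3 * card (S \<inter> F)" if d: "0 < d" "d \<le> m" for d
    proof -
      have "nb_walk E (\<lambda>i. x (i + 2 * d)) (2 * (m - d))"
        using d by (intro nb_walk_shift[OF walk]) auto
      moreover have "x (2 * i + 2 * d) \<in> Z (Suc s)" if "i \<le> m - d" for i
        using zero[of "i + d"] that d by (simp add: algebra_simps)
      moreover have "2 * (m - d) + 2 * d = 2 * m" using d by simp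
      ultimately obtain S where S: "finite S" "connected_in (st_adj E) S" "(x (2 * d), Suc s) \<in> S"
        "(x (2 * m), Suc s) \<in> S"
        "\<And>v r. (v, r) \<in> S \<Longrightarrow> v \<in> Z r \<and> (\<exists>i\<le>m - d. descendant E Z (x (2 * i + 2 * d)) (Suc s) v r)"
        "card S + 2 * (m - d + 1) \<le> 3 * card (S \<inter> F)"
        using less.IH[of "m - d" "\<lambda>i. x (i + 2 * d)"] d by auto
      moreover have "\<exists>i. d \<le> i \<and> i \<le> m \<and> descendant E Z (x (2 * i)) (Suc s) v r"
        if vr: "(v, r) \<in> S" for v r
      proof -
        obtain i where "i \<le> m - d" "descendant E Z (x (2 * i + 2 * d)) (Suc s) v r"
          using S(5)[OF vr] by blast
        then show ?thesis using d by (intro exI[of _ "i + d"]) (auto simp: algebra_simps)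
      qed
      ultimately show ?thesis by blast
    qed
    show ?case
    proof (cases "?good (x 0)")
      case False
      have x0: "x 0 \<in> Z (Suc s)" "(x 0, Suc s) \<in> F"
        using zero[of 0] spontaneous[of "x 0" s] False by auto
      show ?thesis
      proof (cases "m = 0")
        case True
        then show ?thesis using x0
          by (intro exI[of _ "{(x 0, Suc s)}"])
             (auto simp: connected_in_singleton intro: descendant.self)
      next
        case False
        then obtain S where S: "finite S" "connected_in (st_adj E) S" "(x (2 * 1), Suc s) \<in> S"
          "(x (2 * m), Suc s) \<in> S"
          "\<And>v r. (v, r) \<in> S \<Longrightarrow> v \<in> Z r
              \<and> (\<exists>i. 1 \<le> i \<and> i \<le> m \<and> descendant E Z (x (2 * i)) (Suc s) v r)"
          "card S + 2 * (m - 1 + 1) \<le> 3 * card (S \<inter> F)"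
          using rest[of 1] by auto
        have new: "(x 0, Suc s) \<notin> S"
        proof
          assume "(x 0, Suc s) \<in> S"
          then obtain i where "1 \<le> i" "i \<le> m" "descendant E Z (x (2 * i)) (Suc s) (x 0) (Suc s)"
            using S(5) by blast
          then show False
            using descendant_same_time nb_walk_distinct[OF acyclic walk, of 0 "2 * i"] by fastforce
        qed
        let ?S = "insert (x 0, Suc s) S"
        have "connected_in (st_adj E) ?S"
          using False dist2[of 0] by (intro connected_in_insert[OF symp_st_adj S(2,3)]) (simp add: numeral_2_eq_2)
        moreover have "card ?S + 2 * (m + 1) \<le> 3 * card (?S \<inter> F)"
          using S(1,6) new x0(2) False by (simp add: Int_insert_left)
        moreover have "v \<in> Z r \<and> (\<exists>i\<le>m. descendant E Z (x (2 * i)) (Suc s) v r)"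
          if "(v, r) \<in> ?S" for v r
          using that S(5)[of v r] x0(1) descendant.self[of E Z "x 0" "Suc s"] by force
        ultimately show ?thesis using S(1,4) by (intro exI[of _ ?S]) simp
      qed
    next
      case True
      \<comment> \<open>\<open>k\<close> is the length of the uninterrupted part that starts at \<open>x 0\<close>\<close>
      define P where "P k \<longleftrightarrow> (\<forall>i\<le>k. ?good (x (2 * i))) \<and> (\<forall>i<k. x (2 * i + 1) \<in> Z s)" for k
      have "P 0" using True by (simp add: P_def)
      then obtain k where k: "k \<le> m" "P k" "k < m \<Longrightarrow> \<not> P (Suc k)"
      proof -
        have "\<exists>k\<le>m. P k \<and> (k < m \<longrightarrow> \<not> P (Suc k))"
        proof (rule ccontr)
          assume no: "\<not> ?thesis"
          have "P i" if "i \<le> m" for i using that \<open>P 0\<close> no by (induction i) (auto simp: Suc_le_eq)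
          with no show False by blast
        qed
        then show thesis using that by blast
      qed
      have good: "?good (x (2 * i))" if "i \<le> k" for i using k(2) that by (simp add: P_def)
      have mid: "x (2 * i + 1) \<in> Z s" if "i < k" for i using k(2) that by (simp add: P_def)
      have other: "\<exists>w\<in>nbrs E u \<inter> Z s. w \<noteq> w'" if "?good u" for u w'
      proof (rule ccontr)
        assume "\<not> ?thesis"
        then have "card (nbrs E u \<inter> Z s) \<le> card {w'}" by (intro card_mono) auto
        with that show False by simp
      qed
      \<comment> \<open>the ends of the path one time unit earlier; they must not backtrack, also if \<open>k = 0\<close>\<close>
      obtain wL where wL: "wL \<in> nbrs E (x 0) \<inter> Z s" "wL \<noteq> x 1" using other[OF good[of 0]] by auto
      obtain wR where wR: "wR \<in> nbrs E (x (2 * k)) \<inter> Z s" "wR \<noteq> (if k = 0 then wL else x (2 * k - 1))"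
        using other[OF good[of k]] by auto
      define y where "y i = (if i = 0 then wL else if i \<le> 2 * k + 1 then x (i - 1) else wR)" for i
      have "nb_walk E y (2 * (k + 1))"
        unfolding nb_walk_def
      proof (intro conjI allI impI)
        fix i assume i: "i < 2 * (k + 1)"
        then consider "i = 0" | "0 < i" "i \<le> 2 * k" | "i = 2 * k + 1" by atomize_elim arith
        then show "adj E (y i) (y (Suc i))"
        proof cases
          case 2
          then show ?thesis using adjx[of "i - 1"] k(1) by (auto simp: y_def)
        qed (use wL(1) wR(1) in \<open>auto simp: y_def in_nbrs_iff intro: adj_sym\<close>)
      next
        fix i assume i: "i + 2 \<le> 2 * (k + 1)"
        then consider "i = 0" | "0 < i" "i < 2 * k" | "0 < i" "i = 2 * k" by atomize_elim arith
        then show "y i \<noteq> y (i + 2)"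
        proof cases
          case 1
          then show ?thesis using wL(2) wR(2) by (auto simp: y_def)
        next
          case 2
          then have "x (i - 1) \<noteq> x (i - 1 + 2)"
            using walk[unfolded nb_walk_def, THEN conjunct2, rule_format, of "i - 1"] k(1) by simp
          then show ?thesis using 2 by (auto simp: y_def)
        next
          case 3
          then show ?thesis using wR(2) by (auto simp: y_def)
        qed
      qed
      moreover have y_nbr: "\<exists>l\<le>k. y (2 * i) \<in> nbrs E (x (2 * l)) \<inter> Z s" if i: "i \<le> k + 1" for i
      proof -
        consider "i = 0" | "0 < i" "i \<le> k" | "i = k + 1" using i by atomize_elim arith
        then show ?thesis
        proof cases
          case 1
          then show ?thesis using wL(1) by (intro exI[of _ 0]) (simp add: y_def)
        next
          case 2
          then have e: "2 * i - 1 = 2 * (i - 1) + 1" "y (2 * i) = x (2 * i - 1)" by (auto simp: y_def)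
          have "y (2 * i) \<in> nbrs E (x (2 * (i - 1))) \<inter> Z s"
            unfolding e using mid[of "i - 1"] adjx[of "2 * (i - 1)"] 2 k(1) by (simp add: in_nbrs_iff)
          then show ?thesis using 2 by (intro exI[of _ "i - 1"]) simp
        next
          case 3
          then show ?thesis using wR(1) by (intro exI[of _ k]) (simp add: y_def)
        qed
      qed
      moreover have "y (2 * i) \<in> Z s" if "i \<le> k + 1" for i using y_nbr[OF that] by blast
      moreover have "y 0 = wL" "y (2 * (k + 1)) = wR" by (simp_all add: y_def)
      ultimately obtain S1 where S1: "finite S1" "connected_in (st_adj E) S1" "(wL, s) \<in> S1" "(wR, s) \<in> S1"
        "\<And>v r. (v, r) \<in> S1 \<Longrightarrow> v \<in> Z r \<and> (\<exists>i\<le>k + 1. descendant E Z (y (2 * i)) s v r)"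
        "card S1 + 2 * (k + 1 + 1) \<le> 3 * card (S1 \<inter> F)"
        using IH_time[of y "k + 1"] by metis
      have S1_desc: "\<exists>l\<le>k. \<exists>w\<in>nbrs E (x (2 * l)) \<inter> Z s. descendant E Z w s v r" if "(v, r) \<in> S1" for v r
        using S1(5)[OF that] y_nbr by blast
      define T where "T = insert (x 0, Suc s) (insert (x (2 * k), Suc s) S1)"
      have conT: "connected_in (st_adj E) T"
      proof -
        have *: "connected_in (st_adj E) (insert (x (2 * k), Suc s) S1)"
          using wR(1) by (intro connected_in_insert[OF symp_st_adj S1(2,4)]) (auto simp: in_nbrs_iff st_adj_down)
        show ?thesis unfolding T_def
          using wL(1) S1(3) by (intro connected_in_insert[OF symp_st_adj *, where b = "(wL, s)"])
            (auto simp: in_nbrs_iff st_adj_down)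
      qed
      have finT: "finite T" using S1(1) by (simp add: T_def)
      have cardT: "card T \<le> card S1 + 2"
        using card_insert_le_m1 S1(1) unfolding T_def by (simp add: card_insert_if)
      have T_desc: "v \<in> Z r \<and> (\<exists>i\<le>m. descendant E Z (x (2 * i)) (Suc s) v r)" if vr: "(v, r) \<in> T" for v r
      proof (cases "(v, r) \<in> S1")
        case True
        then obtain l w where "l \<le> k" "w \<in> nbrs E (x (2 * l)) \<inter> Z s" "descendant E Z w s v r"
          using S1_desc by blast
        then have "descendant E Z (x (2 * l)) (Suc s) v r" using good by (intro descendant.child)
        then show ?thesis using S1(5)[OF True] \<open>l \<le> k\<close> k(1) by (meson le_trans)
      next
        case False
        then have "(v, r) = (x (2 * 0), Suc s) \<or> (v, r) = (x (2 * k), Suc s)" using vr by (auto simp: T_def)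
        then show ?thesis
        proof
          assume "(v, r) = (x (2 * 0), Suc s)"
          then show ?thesis using zero[of 0] descendant.self[of E Z "x (2 * 0)" "Suc s"] by blast
        next
          assume "(v, r) = (x (2 * k), Suc s)"
          then show ?thesis using zero[of k] k(1) descendant.self[of E Z "x (2 * k)" "Suc s"] by blast
        qed
      qed
      show ?thesis
      proof (cases "k = m")
        case True
        have "card (S1 \<inter> F) \<le> card (T \<inter> F)" using finT by (intro card_mono) (auto simp: T_def)
        then have "card T + 2 * (m + 1) \<le> 3 * card (T \<inter> F)" using cardT S1(6) True by (simp add: algebra_simps)
        then show ?thesis using finT conT T_desc True by (intro exI[of _ T]) (auto simp: T_def)
      next
        case False
        then have km: "k < m" using k(1) by simp
        obtain S2 where S2: "finite S2" "connected_in (st_adj E) S2" "(x (2 * Suc k), Suc s) \<in> S2"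
          "(x (2 * m), Suc s) \<in> S2"
          "\<And>v r. (v, r) \<in> S2 \<Longrightarrow> v \<in> Z r
              \<and> (\<exists>i. Suc k \<le> i \<and> i \<le> m \<and> descendant E Z (x (2 * i)) (Suc s) v r)"
          "card S2 + 2 * (m - Suc k + 1) \<le> 3 * card (S2 \<inter> F)"
          using rest[of "Suc k"] km by auto
        have sep: "separated E (Z s) w q"
          if l: "l \<le> k" "w \<in> nbrs E (x (2 * l)) \<inter> Z s"
            and i: "Suc k \<le> i" "i \<le> m" "q \<in> nbrs E (x (2 * i)) \<inter> Z s" "?good (x (2 * i))" for l w i q
        proof -
          \<comment> \<open>the cut after position \<open>2 * k\<close> is a one at \<open>x (2 * k + 1)\<close>; or \<open>x (2 * k + 2)\<close> is noise,
            and then \<open>x (2 * k + 1)\<close> is its only zero neighbour, so \<open>x (2 * k + 3)\<close> is a one\<close>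
          obtain c where c: "odd c" "2 * l < c" "c < 2 * i" "x c \<notin> Z s"
          proof (cases "x (2 * k + 1) \<in> Z s")
            case False
            then show thesis using that[of "2 * k + 1"] l i by auto
          next
            case True
            have bad: "\<not> ?good (x (2 * Suc k))"
              using k(3)[OF km] k(2) True unfolding P_def by (auto simp: le_Suc_eq less_Suc_eq)
            then have "i \<noteq> Suc k" using i(4) by blast
            then have "Suc k < i" using i(1) by simp
            have "adj E (x (2 * k + 1)) (x (2 * Suc k))" "adj E (x (2 * Suc k)) (x (2 * k + 3))"
              using adjx[of "2 * k + 1"] adjx[of "2 * k + 2"] \<open>Suc k < i\<close> i(2)
              by (simp_all add: eval_nat_numeral)
            moreover have "x (2 * k + 1) \<noteq> x (2 * k + 3)"
              using walk[unfolded nb_walk_def, THEN conjunct2, rule_format, of "2 * k + 1"]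
                \<open>Suc k < i\<close> i(2) by (simp add: eval_nat_numeral)
            ultimately have "x (2 * k + 3) \<notin> Z s"
              using two_nbrs_card[OF adj_sym _ _ True] bad by blast
            then show thesis using that[of "2 * k + 3"] l(1) \<open>Suc k < i\<close> by auto
          qed
          have w: "nb_walk E (\<lambda>a. x (a + 2 * l)) (2 * i - 2 * l)"
            using i l by (intro nb_walk_shift[OF walk]) auto
          show ?thesis
            using c l i by (intro separated_one_step_back[OF w, of "c - 2 * l"])
              (auto simp: in_nbrs_iff intro: adj_sym)
        qed
        have disj: "S1 \<inter> S2 = {}"
        proof (rule ccontr)
          assume "S1 \<inter> S2 \<noteq> {}"
          then obtain v r where v: "(v, r) \<in> S1" "(v, r) \<in> S2" by auto
          obtain l w where l: "l \<le> k" "w \<in> nbrs E (x (2 * l)) \<inter> Z s" "descendant E Z w s v r"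
            using S1_desc[OF v(1)] by blast
          obtain i where i: "Suc k \<le> i" "i \<le> m" "descendant E Z (x (2 * i)) (Suc s) v r"
            using S2(5)[OF v(2)] by blast
          obtain q where q: "?good (x (2 * i))" "q \<in> nbrs E (x (2 * i)) \<inter> Z s" "descendant E Z q s v r"
            using descendant_earlier[OF i(3) descendant_le[OF l(3)]] by blast
          show False
            using separated_descendants_neq[OF sep[OF l(1,2) i(1,2) q(2,1)] l(3) q(3)] by simp
        qed
        let ?S = "T \<union> S2"
        have "connected_in (st_adj E) ?S"
        proof (rule connected_in_Un[OF symp_st_adj conT S2(2)])
          show "(x (2 * k), Suc s) \<in> T" by (simp add: T_def)
          show "(x (2 * Suc k), Suc s) \<in> S2" by (rule S2(3))
          show "st_adj E (x (2 * k), Suc s) (x (2 * Suc k), Suc s)" using dist2[of "2 * k"] km by simp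
        qed
        moreover have "card ?S + 2 * (m + 1) \<le> 3 * card (?S \<inter> F)"
        proof -
          have "card ((S1 \<inter> F) \<union> (S2 \<inter> F)) \<le> card (?S \<inter> F)"
            using finT S2(1) by (intro card_mono) (auto simp: T_def)
          moreover have "card ((S1 \<inter> F) \<union> (S2 \<inter> F)) = card (S1 \<inter> F) + card (S2 \<inter> F)"
            using S1(1) S2(1) disj by (intro card_Un_disjoint) auto
          moreover have "card ?S \<le> card T + card S2" by (rule card_Un_le)
          moreover obtain d where "m = Suc k + d" using km less_iff_Suc_add by auto
          ultimately show ?thesis using cardT S1(6) S2(6) by simp
        qed
        moreover have "v \<in> Z r \<and> (\<exists>i\<le>m. descendant E Z (x (2 * i)) (Suc s) v r)" if "(v, r) \<in> ?S" for v r
          using that T_desc[of v r] S2(5)[of v r] by blast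
        moreover have "finite ?S" "(x 0, Suc s) \<in> ?S" "(x (2 * m), Suc s) \<in> ?S"
          using finT S2(1,4) by (auto simp: T_def)
        ultimately show ?thesis by (intro exI[of _ ?S] conjI allI impI) blast+
      qed
    qed
  qed
qed

proposition tree_error_cluster:
  assumes "x \<in> Z t"
  shows "\<exists>S. error_cluster E 3 F (x, t) S \<and> (\<forall>y s. (y, s) \<in> S \<longrightarrow> y \<in> Z s \<and> s \<le> t)"
proof -
  have "nb_walk E (\<lambda>_. x) (2 * 0)" by (simp add: nb_walk_def)
  from tree_cluster[OF this, of t] assms
  obtain S where S: "finite S" "connected_in (st_adj E) S" "(x, t) \<in> S"
    "\<And>v r. (v, r) \<in> S \<Longrightarrow> v \<in> Z r \<and> descendant E Z x t v r" "card S + 2 \<le> 3 * card (S \<inter> F)"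
    by auto
  then show ?thesis using descendant_le unfolding error_cluster_def
    by (intro exI[of _ S]) fastforce
qed

end

section \<open>The Peierls estimate\<close>

text \<open>
  All that the estimate needs of the noise; it holds for the given variables and also for the noise
  read backwards in time, which drives the coupling from the past.
\<close>
definition independent_errors ::
  "'w measure \<Rightarrow> 'v set \<Rightarrow> nat \<Rightarrow> real \<Rightarrow> ('w \<Rightarrow> ('v \<times> nat) set) \<Rightarrow> bool" where
  "independent_errors M V t \<epsilon> F \<longleftrightarrow>
     (\<forall>G. finite G \<longrightarrow> G \<subseteq> V \<times> {1..t} \<longrightarrow> {\<omega>\<in>space M. G \<subseteq> F \<omega>} \<in> sets M
        \<and> measure M {\<omega>\<in>space M. G \<subseteq> F \<omega>} \<le> \<epsilon> ^ card G)"

text \<open>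
  The number of neighbours in the space-time graph is less than \<open>D = (\<Delta> + 1)\<^sup>2\<close>. A walk with \<open>n\<close>
  vertices has at most \<open>2 ^ n\<close> subsets, and a subset of at least \<open>n / 2k\<close> noise points has
  probability at most \<open>(8 * D) ^ - n\<close> below this noise level, so that the walks with \<open>n\<close> vertices
  contribute at most \<open>(1 / 4) ^ n\<close>.
\<close>
definition peierls_threshold :: "'v set \<Rightarrow> 'v set set \<Rightarrow> nat \<Rightarrow> real" where
  "peierls_threshold V E k = (1 / (8 * (real (max_degree V E) + 1) ^ 2)) ^ (2 * k)"

lemma peierls_threshold_pos: "0 < peierls_threshold V E k"
  by (simp add: peierls_threshold_def)

lemma peierls_threshold_le_1: "peierls_threshold V E k \<le> 1"
proof -
  have "1 \<le> (real (max_degree V E) + 1) ^ 2" by (rule one_le_power) simp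
  then have "1 \<le> 8 * (real (max_degree V E) + 1) ^ 2" by linarith
  then have "1 / (8 * (real (max_degree V E) + 1) ^ 2) \<le> 1" by (simp add: divide_le_eq_1)
  then show ?thesis unfolding peierls_threshold_def by (intro power_le_one) simp_all
qed

lemma independent_errorsD:
  assumes "independent_errors M V t \<epsilon> F" "finite G" "G \<subseteq> V \<times> {1..t}"
  shows "{\<omega>\<in>space M. G \<subseteq> F \<omega>} \<in> sets M"
    "measure M {\<omega>\<in>space M. G \<subseteq> F \<omega>} \<le> \<epsilon> ^ card G"
  using assms by (simp_all add: independent_errors_def)

lemma (in bounded_graph) peierls_estimate:
  assumes "prob_space M" and indep: "independent_errors M V t \<epsilon> F"
    and eps: "0 \<le> \<epsilon>" "\<epsilon> \<le> peierls_threshold V E k"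
    and A: "A \<subseteq> space M"
    and cluster: "\<And>\<omega>. \<omega> \<in> A \<Longrightarrow> \<exists>S. error_cluster E k (F \<omega>) p S \<and> S \<subseteq> V \<times> {1..t}"
  shows "measure M A \<le> 1 / 3"
proof -
  interpret prob_space M by fact
  define D where "D = max_degree V E ^ 2 + 2 * max_degree V E"
  define r :: real where "r = 1 / (8 * (real (max_degree V E) + 1) ^ 2)"
  have D1: "real D + 1 = (real (max_degree V E) + 1) ^ 2"
    by (simp add: D_def power2_eq_square algebra_simps)
  then have r: "0 < r" "r \<le> 1" "8 * r * (real D + 1) = 1"
    unfolding r_def D1[symmetric] by (simp_all add: divide_le_eq field_simps)
  let ?bad = "\<lambda>G. {\<omega>\<in>space M. G \<subseteq> F \<omega>}"
  define \<G> where "\<G> m xs = {G. G \<subseteq> set xs \<and> G \<subseteq> V \<times> {1..t} \<and> Suc m \<le> 2 * k * card G}" for m xs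
  define U where "U m = (\<Union>xs\<in>walks_from (st_adj E) p m. \<Union>G\<in>\<G> m xs. ?bad G)" for m
  have fin_walks: "finite (walks_from (st_adj E) p m)" "card (walks_from (st_adj E) p m) \<le> D ^ m" for m
    using card_walks_from_le[of "st_adj E" D p m] finite_card_st_adj by (auto simp: D_def)
  have fin_G: "finite (\<G> m xs)" "G \<in> \<G> m xs \<Longrightarrow> finite G" for m xs G
  proof -
    have "\<G> m xs \<subseteq> Pow (set xs)" by (auto simp: \<G>_def)
    then show "finite (\<G> m xs)" by (rule finite_subset) simp
    show "finite G" if "G \<in> \<G> m xs"
      using that unfolding \<G>_def by (blast intro: finite_subset[OF _ finite_set])
  qed
  have bad: "?bad G \<in> sets M" "prob (?bad G) \<le> r ^ Suc m" if "G \<in> \<G> m xs" for m xs G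
  proof -
    have *: "finite G" "G \<subseteq> V \<times> {1..t}" "Suc m \<le> 2 * k * card G"
      using fin_G(2)[OF that] that by (simp_all add: \<G>_def)
    show "?bad G \<in> sets M" by (rule independent_errorsD(1)[OF indep *(1,2)])
    have "prob (?bad G) \<le> \<epsilon> ^ card G" by (rule independent_errorsD(2)[OF indep *(1,2)])
    also have "\<dots> \<le> (r ^ (2 * k)) ^ card G"
      using eps unfolding peierls_threshold_def r_def by (intro power_mono) auto
    also have "\<dots> = r ^ (2 * k * card G)" by (simp add: power_mult)
    also have "\<dots> \<le> r ^ Suc m" using r *(3) by (intro power_decreasing) auto
    finally show "prob (?bad G) \<le> r ^ Suc m" .
  qed
  have U_sets: "U m \<in> sets M" for m
    unfolding U_def using fin_walks fin_G(1) bad(1) by (intro sets.finite_UN) auto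
  have U_le: "prob (U m) \<le> (1 / 4) ^ Suc m" for m
  proof -
    have inner: "prob (\<Union>G\<in>\<G> m xs. ?bad G) \<le> 2 ^ Suc m * r ^ Suc m"
      if xs: "xs \<in> walks_from (st_adj E) p m" for xs
    proof -
      have "prob (\<Union>G\<in>\<G> m xs. ?bad G) \<le> (\<Sum>G\<in>\<G> m xs. prob (?bad G))"
        using fin_G(1) bad(1) by (intro finite_measure_subadditive_finite) auto
      also have "\<dots> \<le> (\<Sum>G\<in>\<G> m xs. r ^ Suc m)" using bad(2) by (intro sum_mono)
      also have "\<dots> = card (\<G> m xs) * r ^ Suc m" by simp
      also have "\<dots> \<le> 2 ^ Suc m * r ^ Suc m"
      proof (intro mult_right_mono)
        have "card (\<G> m xs) \<le> card (Pow (set xs))" by (intro card_mono) (auto simp: \<G>_def)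
        also have "card (Pow (set xs)) = 2 ^ card (set xs)" by (rule card_Pow) simp
        also have "\<dots> \<le> 2 ^ Suc m"
          using xs card_length[of xs] unfolding walks_from_def by (intro power_increasing) auto
        finally have "real (card (\<G> m xs)) \<le> real (2 ^ Suc m)" by (rule of_nat_mono)
        then show "real (card (\<G> m xs)) \<le> 2 ^ Suc m" by simp
      qed (use r in auto)
      finally show ?thesis .
    qed
    have "prob (U m) \<le> (\<Sum>xs\<in>walks_from (st_adj E) p m. prob (\<Union>G\<in>\<G> m xs. ?bad G))"
      unfolding U_def using fin_walks fin_G(1) bad(1)
      by (intro finite_measure_subadditive_finite) (auto intro!: sets.finite_UN)
    also have "\<dots> \<le> (\<Sum>xs\<in>walks_from (st_adj E) p m. 2 ^ Suc m * r ^ Suc m)"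
      using inner by (intro sum_mono)
    also have "\<dots> = card (walks_from (st_adj E) p m) * (2 ^ Suc m * r ^ Suc m)" by simp
    also have "\<dots> \<le> (real D + 1) ^ Suc m * (2 ^ Suc m * r ^ Suc m)"
    proof (intro mult_right_mono)
      have "real (card (walks_from (st_adj E) p m)) \<le> real D ^ m"
        using of_nat_mono[OF fin_walks(2)[of m], where 'a = real] by simp
      also have "\<dots> \<le> (real D + 1) ^ m" by (intro power_mono) auto
      also have "\<dots> \<le> (real D + 1) ^ Suc m" by (intro power_increasing) auto
      finally show "real (card (walks_from (st_adj E) p m)) \<le> (real D + 1) ^ Suc m" .
    qed (use r in auto)
    also have "\<dots> = ((real D + 1) * (2 * r)) ^ Suc m" by (simp only: power_mult_distrib)
    also have "(real D + 1) * (2 * r) = 1 / 4" using r(3) by (simp add: algebra_simps)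
    finally show ?thesis .
  qed
  have "A \<subseteq> (\<Union>m. U m)"
  proof
    fix \<omega> assume \<omega>: "\<omega> \<in> A"
    then obtain S where S: "error_cluster E k (F \<omega>) p S" "S \<subseteq> V \<times> {1..t}" using cluster by blast
    then have S': "finite S" "connected_in (st_adj E) S" "p \<in> S" "card S \<le> k * card (S \<inter> F \<omega>)"
      by (auto simp: error_cluster_def)
    obtain xs where xs: "xs \<noteq> []" "hd xs = p" "successively (st_adj E) xs" "set xs = S"
      "length xs < 2 * card S"
      using connected_set_covered_by_walk[OF symp_st_adj S'(1-3)] by blast
    define m where "m = length xs - 1"
    have m: "length xs = Suc m" using xs(1) by (simp add: m_def)
    then have "xs \<in> walks_from (st_adj E) p m" using xs by (simp add: walks_from_def)
    moreover have "S \<inter> F \<omega> \<in> \<G> m xs" using S(2) xs(4,5) m S'(4) by (auto simp: \<G>_def)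
    moreover have "\<omega> \<in> ?bad (S \<inter> F \<omega>)" using \<omega> A by auto
    ultimately show "\<omega> \<in> (\<Union>m. U m)" unfolding U_def by blast
  qed
  then have A_le: "prob A \<le> prob (\<Union>m. U m)" using U_sets by (intro finite_measure_mono) auto
  have sums: "(\<lambda>m. (1 / 4 :: real) ^ Suc m) sums (1 / 3)"
    using sums_mult[OF geometric_sums[of "1 / 4 :: real"], of "1 / 4"] by simp
  have summ: "summable (\<lambda>m. prob (U m))"
    by (rule summable_comparison_test'[OF sums_summable[OF sums], of 0])
       (use U_le in \<open>simp del: power_Suc\<close>)
  note A_le
  also have "prob (\<Union>m. U m) \<le> (\<Sum>m. prob (U m))"
    using U_sets summ by (intro finite_measure_subadditive_countably) auto
  also have "\<dots> \<le> (\<Sum>m. (1 / 4) ^ Suc m)"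
    using U_le summ sums_summable[OF sums] by (intro suminf_le)
  also have "\<dots> = 1 / 3" using sums by (rule sums_unique[symmetric])
  finally show ?thesis .
qed

section \<open>Zeros of the consensus process\<close>

definition errors :: "real \<Rightarrow> ('v \<Rightarrow> nat \<Rightarrow> real) \<Rightarrow> ('v \<times> nat) set" where
  "errors \<epsilon> l = {(x, t). l x t \<notin> {\<epsilon>..1}}"

lemma trajectory_invariant:
  assumes "R \<eta> \<eta>'" "\<And>l \<eta> \<eta>'. R \<eta> \<eta>' \<Longrightarrow> R (step l \<eta>) (step' l \<eta>')"
  shows "R (trajectory step l \<eta> t) (trajectory step' l \<eta>' t)"
  using assms by (induction t) auto

lemma (in bounded_graph) Phi_V_le_Phi_E:
  assumes "V \<noteq> {}"
  shows "Phi_V V E \<le> Phi_E V E"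
  unfolding Phi_E_def
proof (rule cINF_greatest)
  obtain x where "x \<in> V" using assms by blast
  then have "{x} \<in> {K. K \<subseteq> V \<and> finite K \<and> K \<noteq> {}}" by simp
  then show "{K. K \<subseteq> V \<and> finite K \<and> K \<noteq> {}} \<noteq> {}" by (metis (lifting) empty_iff)
next
  fix K assume K: "K \<in> {K. K \<subseteq> V \<and> finite K \<and> K \<noteq> {}}"
  have sub: "vertex_boundary V E K \<subseteq> (\<lambda>e. the_elem (e - K)) ` edge_boundary E K"
  proof
    fix x assume "x \<in> vertex_boundary V E K"
    then obtain y where y: "x \<notin> K" "y \<in> K" "adj E x y" unfolding vertex_boundary_def by blast
    have diff: "{x, y} - K = {x}" and int: "{x, y} \<inter> K = {y}" using y(1,2) by auto
    have "{x, y} \<in> edge_boundary E K" using y(3) unfolding edge_boundary_def adj_def by (simp only: int mem_Collect_eq) simp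
    moreover have "x = the_elem ({x, y} - K)" unfolding diff by simp
    ultimately show "x \<in> (\<lambda>e. the_elem (e - K)) ` edge_boundary E K" by blast
  qed
  have "finite (edge_boundary E K)" using K by (intro finite_edge_boundary) simp
  from surj_card_le[OF this sub] have "card (vertex_boundary V E K) \<le> card (edge_boundary E K)" .
  then have "real (card (vertex_boundary V E K)) / real (card K) \<le> real (card (edge_boundary E K)) / real (card K)"
    by (intro divide_right_mono) simp_all
  moreover have "Phi_V V E \<le> real (card (vertex_boundary V E K)) / real (card K)"
    unfolding Phi_V_def by (rule cINF_lower[OF _ K]) (rule bdd_belowI2[of _ 0], simp)
  ultimately show "Phi_V V E \<le> real (card (edge_boundary E K)) / real (card K)" by linarith
qed

text \<open>
  The first condition suffices because \<open>\<Phi>\<^sub>E \<le> \<Delta>\<close>, the third because \<open>\<Phi>\<^sub>V \<le> \<Phi>\<^sub>E\<close>.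
\<close>
lemma (in bounded_graph) chi_good_cases:
  assumes "V \<noteq> {}" "chi_good V E j"
  shows "j < Phi_E V E + 1 \<or> (\<exists>d. regular_tree V E d \<and> 2 \<le> d \<and> j < d)"
proof -
  obtain x where "x \<in> V" using assms(1) by blast
  then have "Phi_E V E \<le> max_degree V E" using Phi_E_le_deg[of x] deg_le_max_degree[of x] by linarith
  moreover have "2 * real j < 3 * Phi_E V E - real (max_degree V E) + 2 \<or> real j < Phi_E V E + 1
      \<or> real j < Phi_V V E \<or> (\<exists>d\<ge>2. regular_tree V E d \<and> j < d)"
    using assms(2) unfolding chi_good_def by blast
  ultimately have "real j < Phi_E V E + 1 \<or> (\<exists>d\<ge>2. regular_tree V E d \<and> j < d)"
    using Phi_V_le_Phi_E[OF assms(1)] by (elim disjE) auto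
  then show ?thesis by blast
qed

context bounded_graph
begin

lemma nbr_count_eq_card:
  assumes "\<And>y. y \<in> V \<Longrightarrow> \<eta> y \<in> {0, 1}"
  shows "nbr_count E \<eta> x = card (nbrs E x - {y \<in> V. \<eta> y = 0})"
proof -
  have "nbr_count E \<eta> x = (\<Sum>y\<in>nbrs E x. if y \<in> {y \<in> V. \<eta> y = 0} then 0 else 1)"
    unfolding nbr_count_def using assms nbrs_subset_V by (intro sum.cong) fastforce+
  also have "\<dots> = card (nbrs E x - {y \<in> V. \<eta> y = 0})" by (simp add: sum.If_cases Diff_eq)
  finally show ?thesis .
qed

lemma nbr_count_mono: "(\<And>y. y \<in> V \<Longrightarrow> \<eta> y \<le> \<eta>' y) \<Longrightarrow> nbr_count E \<eta> x \<le> nbr_count E \<eta>' x"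
  unfolding nbr_count_def using nbrs_subset_V by (intro sum_mono) auto

definition le_on :: "('v \<Rightarrow> nat) \<Rightarrow> ('v \<Rightarrow> nat) \<Rightarrow> bool" where
  "le_on \<eta> \<eta>' \<longleftrightarrow> (\<forall>x\<in>V. \<eta> x \<le> \<eta>' x)"

lemma consensus_step_mono:
  assumes "le_on \<eta> \<eta>'" "j' \<le> j"
  shows "le_on (consensus_step V E j \<epsilon> l \<eta>) (consensus_step V E j' \<epsilon> l \<eta>')"
proof -
  have "nbr_count E \<eta> x \<le> nbr_count E \<eta>' x" for x
    using assms(1) by (intro nbr_count_mono) (simp add: le_on_def)
  then have "j' \<le> nbr_count E \<eta>' x" if "j \<le> nbr_count E \<eta> x" for x
    using that assms(2) by (meson le_trans)
  then show ?thesis by (simp add: le_on_def consensus_step_def)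
qed

lemma consensus_binary:
  "x \<in> V \<Longrightarrow> trajectory (consensus_step V E j \<epsilon>) l (all_ones V) t x \<in> {0, 1}"
  by (cases t) (simp_all add: all_ones_def consensus_step_def)

definition zeros :: "nat \<Rightarrow> real \<Rightarrow> ('v \<Rightarrow> nat \<Rightarrow> real) \<Rightarrow> nat \<Rightarrow> 'v set" where
  "zeros j \<epsilon> l t = {x \<in> V. trajectory (consensus_step V E j \<epsilon>) l (all_ones V) t x = 0}"

lemma zeros_subset_V: "zeros j \<epsilon> l t \<subseteq> V"
  by (auto simp: zeros_def)

lemma zeros_0: "zeros j \<epsilon> l 0 = {}"
  by (auto simp: zeros_def all_ones_def)

lemma zeros_Suc:
  "zeros j \<epsilon> l (Suc t) = {x \<in> V. (x, Suc t) \<in> errors \<epsilon> l \<or> card (nbrs E x - zeros j \<epsilon> l t) < j}"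
proof -
  have "nbr_count E (trajectory (consensus_step V E j \<epsilon>) l (all_ones V) t) x = card (nbrs E x - zeros j \<epsilon> l t)" for x
    unfolding zeros_def by (rule nbr_count_eq_card[OF consensus_binary])
  then show ?thesis by (auto simp: zeros_def[of _ _ _ "Suc t"] errors_def consensus_step_def)
qed

lemma zeros_mono:
  assumes "j' \<le> j"
  shows "zeros j' \<epsilon> l t \<subseteq> zeros j \<epsilon> l t"
proof -
  have "le_on (trajectory (consensus_step V E j \<epsilon>) l (all_ones V) t)
      (trajectory (consensus_step V E j' \<epsilon>) l (all_ones V) t)"
  proof (rule trajectory_invariant)
    show "le_on (all_ones V) (all_ones V)" by (simp add: le_on_def)
  qed (rule consensus_step_mono[OF _ assms])
  then show ?thesis by (auto simp: zeros_def le_on_def)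
qed

proposition chi_good_error_cluster:
  assumes "V \<noteq> {}" "chi_good V E j"
  shows "\<exists>k. \<forall>\<epsilon> l t. \<forall>x\<in>zeros j \<epsilon> l t. \<exists>S. error_cluster E k (errors \<epsilon> l) (x, t) S \<and> S \<subseteq> V \<times> {1..t}"
proof -
  have within: "S \<subseteq> V \<times> {1..t}" if S: "\<forall>y s. (y, s) \<in> S \<longrightarrow> y \<in> zeros i \<epsilon> l s \<and> s \<le> t" for S t i \<epsilon> l
  proof
    fix p assume "p \<in> S"
    then obtain y s where p: "p = (y, s)" "y \<in> zeros i \<epsilon> l s" "s \<le> t" using S by (cases p) auto
    then have "s \<noteq> 0" using zeros_0[of i \<epsilon> l] by (metis empty_iff)
    with p show "p \<in> V \<times> {1..t}" by (auto simp: zeros_def)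
  qed
  show ?thesis
  proof (cases "j < Phi_E V E + 1")
    case True
    from expanding_error_cluster[OF True] obtain k where k: "\<forall>Z F. Z 0 = {} \<longrightarrow> (\<forall>s. Z s \<subseteq> V)
       \<longrightarrow> (\<forall>x s. x \<in> Z (Suc s) \<longrightarrow> (x, Suc s) \<notin> F \<longrightarrow> card (nbrs E x - Z s) < j)
       \<longrightarrow> (\<forall>t. \<forall>x\<in>Z t. \<exists>S. error_cluster E k F (x, t) S \<and> (\<forall>y s. (y, s) \<in> S \<longrightarrow> y \<in> Z s \<and> s \<le> t))"
      by (elim exE)
    show ?thesis
    proof (intro exI[of _ k] allI ballI)
      fix \<epsilon> l t x assume "x \<in> zeros j \<epsilon> l t"
      then have "\<exists>S. error_cluster E k (errors \<epsilon> l) (x, t) S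
          \<and> (\<forall>y s. (y, s) \<in> S \<longrightarrow> y \<in> zeros j \<epsilon> l s \<and> s \<le> t)"
        by (intro k[rule_format]) (simp_all add: zeros_0 zeros_subset_V zeros_Suc)
      then show "\<exists>S. error_cluster E k (errors \<epsilon> l) (x, t) S \<and> S \<subseteq> V \<times> {1..t}"
        using within by blast
    qed
  next
    case False
    then obtain d where d: "regular_tree V E d" "2 \<le> d" "j < d" using chi_good_cases[OF assms] by blast
    show ?thesis
    proof (intro exI[of _ 3] allI ballI)
      fix \<epsilon> l t x assume x: "x \<in> zeros j \<epsilon> l t"
      \<comment> \<open>raising the threshold to \<open>d - 1\<close> only creates more zeros\<close>
      let ?Z = "zeros (d - 1) \<epsilon> l"
      have split: "card (nbrs E y \<inter> ?Z s) + card (nbrs E y - ?Z s) = d" if "y \<in> V" for y s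
        using d(1) that card_Int_Diff[of "nbrs E y" "?Z s"] by (simp add: regular_tree_def deg_def)
      interpret tree_zeros V E ?Z "errors \<epsilon> l"
      proof
        show "\<not> has_cycle E" using d(1) by (simp add: regular_tree_def)
        show "?Z 0 = {}" by (rule zeros_0)
      next
        fix y s assume "y \<in> ?Z (Suc s)" "(y, Suc s) \<notin> errors \<epsilon> l"
        then have "y \<in> V" "card (nbrs E y - ?Z s) < d - 1" by (simp_all add: zeros_Suc)
        then show "2 \<le> card (nbrs E y \<inter> ?Z s)" using split[of y s] by linarith
      next
        fix y s assume "y \<in> V" "y \<notin> ?Z (Suc s)"
        then have "\<not> card (nbrs E y - ?Z s) < d - 1" by (simp add: zeros_Suc)
        then show "card (nbrs E y \<inter> ?Z s) \<le> 1" using split[OF \<open>y \<in> V\<close>, of s] by linarith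
      qed
      have "j \<le> d - 1" using d(3) by simp
      then have "x \<in> ?Z t" using x zeros_mono by blast
      from tree_error_cluster[OF this]
      show "\<exists>S. error_cluster E 3 (errors \<epsilon> l) (x, t) S \<and> S \<subseteq> V \<times> {1..t}"
        using within by (elim exE conjE) blast
    qed
  qed
qed

end

section \<open>Noise from the past\<close>

abbreviation uniform01 :: "real measure" where
  "uniform01 \<equiv> uniform_measure lborel {0..1}"

abbreviation site_noise :: "'v set \<Rightarrow> ('v \<Rightarrow> real) measure" where
  "site_noise V \<equiv> \<Pi>\<^sub>M x\<in>V. uniform01"

abbreviation past_noise :: "'v set \<Rightarrow> (nat \<Rightarrow> 'v \<Rightarrow> real) measure" where
  "past_noise V \<equiv> \<Pi>\<^sub>M n\<in>UNIV. site_noise V"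

text \<open>
  Coupling from the past: the configuration at time \<open>0\<close> when the process starts at time \<open>- n\<close> and
  \<open>\<omega> i\<close> is the noise at time \<open>- i\<close>.
\<close>
primrec from_past ::
  "(('v \<Rightarrow> real) \<Rightarrow> ('v \<Rightarrow> nat) \<Rightarrow> ('v \<Rightarrow> nat)) \<Rightarrow> ('v \<Rightarrow> nat) \<Rightarrow> nat \<Rightarrow> (nat \<Rightarrow> 'v \<Rightarrow> real) \<Rightarrow> ('v \<Rightarrow> nat)"
where
  "from_past step \<eta> 0 \<omega> = \<eta>"
| "from_past step \<eta> (Suc n) \<omega> = step (\<omega> 0) (from_past step \<eta> n (\<lambda>i. \<omega> (Suc i)))"

lemma from_past_eq_trajectory:
  "from_past step \<eta> n \<omega> = trajectory step (\<lambda>x s. \<omega> (n - s) x) \<eta> n"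
proof -
  have "trajectory step (\<lambda>x s. \<omega> (n - s) x) \<eta> m = from_past step \<eta> m (\<lambda>i. \<omega> (n - m + i))" if "m \<le> n" for m
    using that
  proof (induction m)
    case (Suc m)
    then have shift: "n - m + i = n - Suc m + Suc i" for i by simp
    have "trajectory step (\<lambda>x s. \<omega> (n - s) x) \<eta> m = from_past step \<eta> m (\<lambda>i. \<omega> (n - m + i))"
      using Suc by simp
    then show ?case unfolding shift by simp
  qed simp
  from this[of n] show ?thesis by simp
qed

lemma prob_space_uniform01: "prob_space uniform01"
  by (rule prob_space_uniform_measure) simp_all

lemma prob_space_site_noise: "prob_space (site_noise V)"
  by (rule prob_space_PiM) (rule prob_space_uniform01)

lemma prob_space_past_noise: "prob_space (past_noise V)"
  by (rule prob_space_PiM) (rule prob_space_site_noise)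

lemma uniform01_error:
  assumes "0 \<le> \<epsilon>" "\<epsilon> \<le> 1"
  shows "measure uniform01 (- {\<epsilon>..1}) = \<epsilon>"
proof -
  have "{0..1} \<inter> - {\<epsilon>..1} = {0..<\<epsilon>}" using assms by auto
  then show ?thesis using assms by (subst measure_uniform_measure) auto
qed

lemma sets_PiM_Collect:
  assumes "finite J" "J \<subseteq> I" "\<And>i. i \<in> J \<Longrightarrow> X i \<in> sets (M i)"
  shows "{\<omega> \<in> space (PiM I M). \<forall>i\<in>J. \<omega> i \<in> X i} \<in> sets (PiM I M)"
proof (rule sets.sets_Collect_finite_All[OF _ assms(1)])
  fix i assume i: "i \<in> J"
  then have "(\<lambda>\<omega>. \<omega> i) \<in> measurable (PiM I M) (M i)" using assms(2) by (intro measurable_component_singleton) auto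
  from measurable_sets[OF this assms(3)[OF i]]
  show "{\<omega> \<in> space (PiM I M). \<omega> i \<in> X i} \<in> sets (PiM I M)" by (simp add: vimage_def Int_def conj_commute)
qed

lemma measure_PiM_Collect:
  assumes "\<And>i. prob_space (M i)" "finite J" "J \<subseteq> I" "\<And>i. i \<in> J \<Longrightarrow> X i \<in> sets (M i)"
  shows "measure (PiM I M) {\<omega> \<in> space (PiM I M). \<forall>i\<in>J. \<omega> i \<in> X i} = (\<Prod>i\<in>J. measure (M i) (X i))"
proof -
  interpret product_prob_space M I by (rule product_prob_spaceI) (rule assms(1))
  have "{\<omega> \<in> space (PiM I M). \<forall>i\<in>J. \<omega> i \<in> X i} = prod_emb I M J (Pi\<^sub>E J X)"
    unfolding prod_emb_def using assms(3) by (auto simp: space_PiM Pi_iff)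
  then show ?thesis using measure_PiM_emb[OF assms(3,2,4)] by simp
qed

lemma independent_errors_past_noise:
  fixes V :: "'v set"
  assumes eps: "0 \<le> \<epsilon>" "\<epsilon> \<le> 1"
  shows "independent_errors (past_noise V) V t \<epsilon> (\<lambda>\<omega>. errors \<epsilon> (\<lambda>y s. \<omega> (t - s) y))"
  unfolding independent_errors_def
proof (intro allI impI)
  fix G :: "('v \<times> nat) set" assume G: "finite G" "G \<subseteq> V \<times> {1..t}"
  let ?U = "site_noise V" and ?N = "past_noise V"
  define I where "I = (\<lambda>(y, s). t - s) ` G"
  define H where "H i = {y. (y, t - i) \<in> G}" for i
  define X where "X i = {l \<in> space ?U. \<forall>y\<in>H i. l y \<in> - {\<epsilon>..1}}" for i
  have finI: "finite I" using G(1) by (simp add: I_def)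
  have H: "finite (H i)" "H i \<subseteq> V" for i
  proof -
    have "H i \<subseteq> fst ` G" by (force simp: H_def)
    then show "finite (H i)" using G(1) by (meson finite_imageI finite_subset)
    show "H i \<subseteq> V" using G(2) by (auto simp: H_def)
  qed
  have X: "X i \<in> sets ?U" for i
    unfolding X_def using H by (intro sets_PiM_Collect) auto
  have "measure ?U (X i) = (\<Prod>y\<in>H i. measure uniform01 (- {\<epsilon>..1}))" for i
    unfolding X_def using H by (intro measure_PiM_Collect) (auto simp: prob_space_uniform01)
  then have mX: "measure ?U (X i) = \<epsilon> ^ card (H i)" for i using uniform01_error[OF eps] by simp
  have eq: "{\<omega> \<in> space ?N. G \<subseteq> errors \<epsilon> (\<lambda>y s. \<omega> (t - s) y)} = {\<omega> \<in> space ?N. \<forall>i\<in>I. \<omega> i \<in> X i}"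
  proof (rule Collect_cong, rule conj_cong[OF refl])
    fix \<omega> assume "\<omega> \<in> space ?N"
    then have sp: "\<omega> i \<in> space ?U" for i by (auto simp: space_PiM)
    show "G \<subseteq> errors \<epsilon> (\<lambda>y s. \<omega> (t - s) y) \<longleftrightarrow> (\<forall>i\<in>I. \<omega> i \<in> X i)"
    proof
      assume L: "G \<subseteq> errors \<epsilon> (\<lambda>y s. \<omega> (t - s) y)"
      show "\<forall>i\<in>I. \<omega> i \<in> X i"
      proof
        fix i assume "i \<in> I"
        then have "i \<le> t" by (auto simp: I_def)
        have "\<omega> i y \<notin> {\<epsilon>..1}" if "y \<in> H i" for y
          using L that \<open>i \<le> t\<close> unfolding H_def errors_def by fastforce
        then show "\<omega> i \<in> X i" using sp by (simp add: X_def)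
      qed
    next
      assume R: "\<forall>i\<in>I. \<omega> i \<in> X i"
      show "G \<subseteq> errors \<epsilon> (\<lambda>y s. \<omega> (t - s) y)"
      proof
        fix p assume p: "p \<in> G"
        obtain y s where ys: "p = (y, s)" by (cases p)
        then have "t - s \<in> I" "s \<le> t" using p G(2) by (force simp: I_def, auto)
        then have "y \<in> H (t - s)" using p ys by (simp add: H_def)
        then show "p \<in> errors \<epsilon> (\<lambda>y s. \<omega> (t - s) y)"
          using R \<open>t - s \<in> I\<close> ys unfolding X_def errors_def by fastforce
      qed
    qed
  qed
  have "{\<omega> \<in> space ?N. \<forall>i\<in>I. \<omega> i \<in> X i} \<in> sets ?N"
    using finI X by (intro sets_PiM_Collect) auto
  moreover have "measure ?N {\<omega> \<in> space ?N. \<forall>i\<in>I. \<omega> i \<in> X i} \<le> \<epsilon> ^ card G"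
  proof -
    have "measure ?N {\<omega> \<in> space ?N. \<forall>i\<in>I. \<omega> i \<in> X i} = (\<Prod>i\<in>I. \<epsilon> ^ card (H i))"
      using finI X by (subst measure_PiM_Collect) (auto simp: prob_space_site_noise mX)
    also have "\<dots> = \<epsilon> ^ (\<Sum>i\<in>I. card (H i))" by (simp add: power_sum)
    also have "\<dots> \<le> \<epsilon> ^ card G"
    proof (rule power_decreasing[OF _ eps])
      have "G \<subseteq> (\<lambda>(i, y). (y, t - i)) ` (SIGMA i:I. H i)"
      proof
        fix p assume p: "p \<in> G"
        obtain y s where ys: "p = (y, s)" by (cases p)
        then have "s \<le> t" using p G(2) by auto
        then have "p = (y, t - (t - s))" "t - s \<in> I" "y \<in> H (t - s)"
          using p ys by (simp, force simp: I_def, simp add: H_def)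
        then show "p \<in> (\<lambda>(i, y). (y, t - i)) ` (SIGMA i:I. H i)" by force
      qed
      then have "card G \<le> card (SIGMA i:I. H i)" using finI H by (intro surj_card_le) auto
      then show "card G \<le> (\<Sum>i\<in>I. card (H i))" using finI H by (simp add: card_SigmaI)
    qed
    finally show ?thesis .
  qed
  ultimately show "{\<omega> \<in> space ?N. G \<subseteq> errors \<epsilon> (\<lambda>y s. \<omega> (t - s) y)} \<in> sets ?N \<and>
      measure ?N {\<omega> \<in> space ?N. G \<subseteq> errors \<epsilon> (\<lambda>y s. \<omega> (t - s) y)} \<le> \<epsilon> ^ card G"
    unfolding eq by blast
qed

lemma independent_errors_iid:
  fixes V :: "'v set"
  assumes noise: "iid_uniform_noise V M L" and eps: "0 \<le> \<epsilon>" "\<epsilon> \<le> 1"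
  shows "independent_errors M V t \<epsilon> (\<lambda>\<omega>. errors \<epsilon> (\<lambda>y s. L y s \<omega>))"
  unfolding independent_errors_def
proof (intro allI impI)
  fix G :: "('v \<times> nat) set" assume G: "finite G" "G \<subseteq> V \<times> {1..t}"
  interpret prob_space M using noise by (simp add: iid_uniform_noise_def)
  let ?L = "\<lambda>(x, t). L x t"
  have indep: "indep_vars (\<lambda>_. borel) ?L (V \<times> {1..})" using noise by (simp add: iid_uniform_noise_def)
  have sub: "G \<subseteq> V \<times> {1..}" using G(2) by auto
  have rv: "?L p \<in> borel_measurable M" if "p \<in> G" for p
    using indep sub that unfolding indep_vars_def by blast
  have eq: "{\<omega> \<in> space M. G \<subseteq> errors \<epsilon> (\<lambda>y s. L y s \<omega>)} = {\<omega> \<in> space M. \<forall>p\<in>G. ?L p \<omega> \<in> - {\<epsilon>..1}}"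
    by (force simp: errors_def)
  have meas: "{\<omega> \<in> space M. \<forall>p\<in>G. ?L p \<omega> \<in> - {\<epsilon>..1}} \<in> sets M"
  proof (rule sets.sets_Collect_finite_All[OF _ G(1)])
    fix p assume "p \<in> G"
    from measurable_sets[OF rv[OF this], of "- {\<epsilon>..1}"]
    show "{\<omega> \<in> space M. ?L p \<omega> \<in> - {\<epsilon>..1}} \<in> sets M" by (simp add: vimage_def Int_def conj_commute)
  qed
  have "prob {\<omega> \<in> space M. \<forall>p\<in>G. ?L p \<omega> \<in> - {\<epsilon>..1}} \<le> \<epsilon> ^ card G"
  proof (cases "G = {}")
    case True
    then show ?thesis by simp
  next
    case False
    have single: "prob (?L p -` (- {\<epsilon>..1}) \<inter> space M) = \<epsilon>" if p: "p \<in> G" for p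
    proof -
      have "distr M borel (?L p) = uniform01" using noise p sub by (force simp: iid_uniform_noise_def)
      then have "measure (distr M borel (?L p)) (- {\<epsilon>..1}) = \<epsilon>" using uniform01_error[OF eps] by simp
      then show ?thesis using rv[OF p] by (subst (asm) measure_distr) auto
    qed
    have "{\<omega> \<in> space M. \<forall>p\<in>G. ?L p \<omega> \<in> - {\<epsilon>..1}} = (\<Inter>p\<in>G. ?L p -` (- {\<epsilon>..1}) \<inter> space M)"
      using False by auto
    also have "prob \<dots> = (\<Prod>p\<in>G. prob (?L p -` (- {\<epsilon>..1}) \<inter> space M))"
      using indep False G(1) sub by (intro indep_varsD) auto
    also have "\<dots> = \<epsilon> ^ card G" using single by simp
    finally show ?thesis by simp
  qed
  with meas show "{\<omega> \<in> space M. G \<subseteq> errors \<epsilon> (\<lambda>y s. L y s \<omega>)} \<in> sets M \<and>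
      prob {\<omega> \<in> space M. G \<subseteq> errors \<epsilon> (\<lambda>y s. L y s \<omega>)} \<le> \<epsilon> ^ card G"
    unfolding eq by blast
qed

section \<open>Stationary limits\<close>

lemma space_configs: "space (configs V) = (\<Pi>\<^sub>E x\<in>V. {0, 1})"
  by (simp add: configs_def space_PiM)

locale local_dynamics =
  fixes V :: "'v set" and step :: "('v \<Rightarrow> real) \<Rightarrow> ('v \<Rightarrow> nat) \<Rightarrow> ('v \<Rightarrow> nat)"
  assumes step_measurable: "(\<lambda>(\<eta>, l). step l \<eta>) \<in> measurable (configs V \<Otimes>\<^sub>M site_noise V) (configs V)"
    and step_binary: "\<And>l \<eta> x. \<eta> \<in> space (configs V) \<Longrightarrow> x \<in> V \<Longrightarrow> step l \<eta> x \<in> {0, 1}"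
    and step_undefined: "\<And>l \<eta> x. x \<notin> V \<Longrightarrow> step l \<eta> x = undefined"
    and step_local: "\<And>x. x \<in> V \<Longrightarrow> \<exists>W. finite W \<and> W \<subseteq> V \<and>
      (\<forall>l \<eta> \<eta>'. (\<forall>y\<in>W. \<eta> y = \<eta>' y) \<longrightarrow> step l \<eta> x = step l \<eta>' x)"
begin

lemma step_in_configs: "\<eta> \<in> space (configs V) \<Longrightarrow> step l \<eta> \<in> space (configs V)"
  using step_binary step_undefined by (auto simp: space_configs PiE_iff extensional_def)

lemma from_past_in_configs:
  "\<eta> \<in> space (configs V) \<Longrightarrow> from_past step \<eta> n \<omega> \<in> space (configs V)"
  by (induction n arbitrary: \<omega>) (auto intro: step_in_configs)

lemma from_past_measurable:
  assumes "\<eta> \<in> space (configs V)"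
  shows "from_past step \<eta> n \<in> measurable (past_noise V) (configs V)"
proof (induction n)
  case 0
  have "from_past step \<eta> 0 = (\<lambda>_. \<eta>)" by auto
  then show ?case using assms by simp
next
  case (Suc n)
  have shift: "(\<lambda>\<omega> i. \<omega> (Suc i)) \<in> measurable (past_noise V) (past_noise V)"
    by (intro measurable_abs_UNIV measurable_component_singleton) simp
  have "(\<lambda>\<omega>. (from_past step \<eta> n (\<lambda>i. \<omega> (Suc i)), \<omega> 0))
      \<in> measurable (past_noise V) (configs V \<Otimes>\<^sub>M site_noise V)"
    using measurable_compose[OF shift Suc] by (intro measurable_Pair measurable_component_singleton) simp_all
  from measurable_compose[OF this step_measurable] show ?case by (simp add: comp_def)
qed

lemma kernel_eq:
  assumes "\<eta> \<in> space (configs V)" "A \<in> sets (configs V)"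
  shows "emeasure (transition_kernel V step \<eta>) A
       = emeasure (site_noise V) {l \<in> space (site_noise V). step l \<eta> \<in> A}"
proof -
  have "(\<lambda>l. step l \<eta>) \<in> measurable (site_noise V) (configs V)"
    using measurable_compose[OF measurable_Pair1'[OF assms(1)] step_measurable] by simp
  then show ?thesis unfolding transition_kernel_def
    using assms(2) by (subst emeasure_distr) (auto simp: vimage_def Int_def conj_commute)
qed

lemma kernel_measurable:
  assumes A: "A \<in> sets (configs V)"
  shows "(\<lambda>\<eta>. emeasure (transition_kernel V step \<eta>) A) \<in> borel_measurable (configs V)"
proof -
  interpret U: prob_space "site_noise V" by (rule prob_space_site_noise)
  let ?Q = "(\<lambda>(\<eta>, l). step l \<eta>) -` A \<inter> space (configs V \<Otimes>\<^sub>M site_noise V)"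
  have "(\<lambda>\<eta>. emeasure (site_noise V) (Pair \<eta> -` ?Q)) \<in> borel_measurable (configs V)"
    by (rule U.measurable_emeasure_Pair[OF measurable_sets[OF step_measurable A]])
  also have "?this \<longleftrightarrow> ?thesis"
  proof (rule measurable_cong)
    fix \<eta> assume \<eta>: "\<eta> \<in> space (configs V)"
    have "Pair \<eta> -` ?Q = {l \<in> space (site_noise V). step l \<eta> \<in> A}"
      using \<eta> by (auto simp: space_pair_measure)
    then show "emeasure (site_noise V) (Pair \<eta> -` ?Q) = emeasure (transition_kernel V step \<eta>) A"
      using kernel_eq[OF \<eta> A] by simp
  qed
  finally show ?thesis .
qed

text \<open>
  Locality makes the limit \<open>lim\<close> of the coupling from the past satisfy
  \<open>lim (l, \<omega>) = step l (lim \<omega>)\<close>. As prepending an independent copy \<open>l\<close> does not change the law of the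
  noise, the law of \<open>lim\<close> is invariant. One-site probabilities pass to the limit by continuity
  along the increasing events that the site keeps a given value from time \<open>m\<close> of the coupling on.
\<close>
proposition stationary_limit:
  assumes \<eta>: "\<eta> \<in> space (configs V)"
    and stabilises: "\<forall>\<omega>. \<forall>x\<in>V. \<exists>m. \<forall>n\<ge>m. from_past step \<eta> n \<omega> x = from_past step \<eta> m \<omega> x"
  shows "\<exists>\<mu>. invariant_measure V step \<mu> \<and> (\<forall>x\<in>V. \<forall>a c.
      (\<forall>n. measure (past_noise V) {\<omega> \<in> space (past_noise V). from_past step \<eta> n \<omega> x = a} \<le> c) \<longrightarrow>
      measure \<mu> {\<xi> \<in> space (configs V). \<xi> x = a} \<le> c)"
proof -
  let ?U = "site_noise V" and ?N = "past_noise V" and ?b = "from_past step \<eta>"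
  interpret U: prob_space ?U by (rule prob_space_site_noise)
  interpret N: prob_space ?N by (rule prob_space_past_noise)
  interpret UN: pair_sigma_finite ?U ?N ..
  interpret S: sequence_space ?U ..
  \<comment> \<open>the pointwise limit, written so that its measurability is evident\<close>
  define lim where "lim \<omega> = (\<lambda>x\<in>V. if \<exists>m. \<forall>n\<ge>m. ?b n \<omega> x = 1 then 1 else 0 :: nat)" for \<omega>
  have bin: "?b n \<omega> x \<in> {0, 1}" if "x \<in> V" for n \<omega> x
    using from_past_in_configs[OF \<eta>, of n \<omega>] that unfolding space_configs by (rule PiE_mem)
  have lim_eq: "\<exists>m. \<forall>n\<ge>m. lim \<omega> x = ?b n \<omega> x" if x: "x \<in> V" for \<omega> x
  proof -
    from bspec[OF spec[OF stabilises, of \<omega>] x] obtain m where m0: "\<forall>n\<ge>m. ?b n \<omega> x = ?b m \<omega> x" by (elim exE)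
    define v where "v = ?b m \<omega> x"
    have m: "\<forall>n\<ge>m. ?b n \<omega> x = v" unfolding v_def by (rule m0)
    have v: "v \<in> {0, 1}" using m bin[OF x, of m \<omega>] by simp
    have "lim \<omega> x = v"
    proof (cases "v = 1")
      case True
      then have "\<exists>m. \<forall>n\<ge>m. ?b n \<omega> x = 1" using m by blast
      then show ?thesis using True x by (simp only: lim_def restrict_apply' if_True)
    next
      case False
      then have "?b (max m k) \<omega> x \<noteq> 1" for k using m by simp
      then have "\<not> (\<exists>k. \<forall>n\<ge>k. ?b n \<omega> x = 1)" by (metis max.cobounded2)
      then have "lim \<omega> x = 0" using x by (simp only: lim_def restrict_apply' if_False)
      with False v show ?thesis by simp
    qed
    then show ?thesis using m by (intro exI[of _ m]) simp
  qed
  have ev_eq: "{\<omega> \<in> space ?N. ?b n \<omega> x = a} \<in> sets ?N" if "x \<in> V" for n x a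
  proof -
    have "(\<lambda>\<xi>. \<xi> x) \<in> measurable (configs V) (count_space {0, 1})"
      unfolding configs_def using that by (rule measurable_component_singleton)
    then have "(\<lambda>\<omega>. ?b n \<omega> x) \<in> measurable ?N (count_space {0, 1})"
      by (rule measurable_compose[OF from_past_measurable[OF \<eta>]])
    from measurable_sets[OF this, of "{0, 1} \<inter> {a}"]
    have "(\<lambda>\<omega>. ?b n \<omega> x) -` ({0, 1} \<inter> {a}) \<inter> space ?N \<in> sets ?N" by simp
    also have "(\<lambda>\<omega>. ?b n \<omega> x) -` ({0, 1} \<inter> {a}) \<inter> space ?N = {\<omega> \<in> space ?N. ?b n \<omega> x = a}"
      using bin[OF that] by blast
    finally show ?thesis .
  qed
  have ev_lim: "{\<omega> \<in> space ?N. \<forall>n\<ge>m. ?b n \<omega> x = a} \<in> sets ?N" if "x \<in> V" for m x a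
    using ev_eq[OF that] by (intro sets.sets_Collect_countable_All sets.sets_Collect_imp) auto
  have lim_meas: "lim \<in> measurable ?N (configs V)"
    unfolding lim_def[abs_def] configs_def
  proof (rule measurable_restrict)
    fix x assume x: "x \<in> V"
    have *: "{\<omega> \<in> space ?N. \<exists>m. \<forall>n\<ge>m. ?b n \<omega> x = 1} \<in> sets ?N"
      by (rule sets.sets_Collect_countable_Ex) (rule ev_lim[OF x])
    show "(\<lambda>\<omega>. if \<exists>m. \<forall>n\<ge>m. ?b n \<omega> x = 1 then 1 else 0 :: nat) \<in> measurable ?N (count_space {0, 1})"
      by (rule measurable_If[OF _ _ *]) (rule measurable_const, simp)+
  qed
  have lim_fix: "lim (case_nat l \<omega>) = step l (lim \<omega>)" for l \<omega>
  proof
    fix x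
    show "lim (case_nat l \<omega>) x = step l (lim \<omega>) x"
    proof (cases "x \<in> V")
      case False
      then show ?thesis by (simp add: lim_def step_undefined)
    next
      case True
      then obtain W where W: "finite W" "W \<subseteq> V"
        "\<And>l \<eta> \<eta>'. (\<And>y. y \<in> W \<Longrightarrow> \<eta> y = \<eta>' y) \<Longrightarrow> step l \<eta> x = step l \<eta>' x"
        using step_local[OF True] by metis
      have "\<forall>\<^sub>F n in sequentially. \<forall>y\<in>W. lim \<omega> y = ?b n \<omega> y"
      proof (rule eventually_ball_finite[OF W(1)], rule ballI)
        fix y assume "y \<in> W"
        then have "y \<in> V" using W(2) by blast
        from lim_eq[OF this] show "\<forall>\<^sub>F n in sequentially. lim \<omega> y = ?b n \<omega> y"
          by (simp only: eventually_sequentially)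
      qed
      moreover have "\<forall>\<^sub>F n in sequentially. lim (case_nat l \<omega>) x = ?b (Suc n) (case_nat l \<omega>) x"
      proof -
        obtain m where "\<forall>n\<ge>m. lim (case_nat l \<omega>) x = ?b n (case_nat l \<omega>) x"
          using lim_eq[OF True, of "case_nat l \<omega>"] by (elim exE)
        then have "\<forall>n\<ge>m. lim (case_nat l \<omega>) x = ?b (Suc n) (case_nat l \<omega>) x"
          by (intro allI impI) (drule spec, erule mp, simp)
        then show ?thesis unfolding eventually_sequentially by (rule exI)
      qed
      ultimately have "\<forall>\<^sub>F n in sequentially. lim (case_nat l \<omega>) x = step l (lim \<omega>) x"
      proof eventually_elim
        case (elim n)
        then have "lim (case_nat l \<omega>) x = step l (?b n \<omega>) x" by simp
        also have "\<dots> = step l (lim \<omega>) x" using elim(1) by (intro W(3)) simp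
        finally show ?case .
      qed
      then show ?thesis by simp
    qed
  qed
  define \<mu> where "\<mu> = distr ?N (configs V) lim"
  have "(\<integral>\<^sup>+ \<xi>. emeasure (transition_kernel V step \<xi>) A \<partial>\<mu>) = emeasure \<mu> A" if A: "A \<in> sets (configs V)" for A
  proof -
    let ?Q = "{p \<in> space (?U \<Otimes>\<^sub>M ?N). step (fst p) (lim (snd p)) \<in> A}"
    have cn: "(\<lambda>(l, \<omega>). case_nat l \<omega>) \<in> measurable (?U \<Otimes>\<^sub>M ?N) ?N" by measurable
    have B: "lim -` A \<inter> space ?N \<in> sets ?N" by (rule measurable_sets[OF lim_meas A])
    have Q_eq: "?Q = (\<lambda>(l, \<omega>). case_nat l \<omega>) -` (lim -` A \<inter> space ?N) \<inter> space (?U \<Otimes>\<^sub>M ?N)"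
      using measurable_space[OF cn] by (auto simp: lim_fix split_beta)
    have Q: "?Q \<in> sets (?U \<Otimes>\<^sub>M ?N)" unfolding Q_eq by (rule measurable_sets[OF cn B])
    have "(\<integral>\<^sup>+ \<xi>. emeasure (transition_kernel V step \<xi>) A \<partial>\<mu>)
        = (\<integral>\<^sup>+ \<omega>. emeasure (transition_kernel V step (lim \<omega>)) A \<partial>?N)"
      unfolding \<mu>_def using kernel_measurable[OF A] by (intro nn_integral_distr[OF lim_meas]) simp
    also have "\<dots> = (\<integral>\<^sup>+ \<omega>. emeasure ?U ((\<lambda>l. (l, \<omega>)) -` ?Q) \<partial>?N)"
    proof (rule nn_integral_cong)
      fix \<omega> assume \<omega>: "\<omega> \<in> space ?N"
      have "(\<lambda>l. (l, \<omega>)) -` ?Q = {l \<in> space ?U. step l (lim \<omega>) \<in> A}"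
        using \<omega> by (auto simp: space_pair_measure)
      then show "emeasure (transition_kernel V step (lim \<omega>)) A = emeasure ?U ((\<lambda>l. (l, \<omega>)) -` ?Q)"
        using kernel_eq[OF measurable_space[OF lim_meas \<omega>] A] by simp
    qed
    also have "\<dots> = emeasure (?U \<Otimes>\<^sub>M ?N) ?Q" by (rule UN.emeasure_pair_measure_alt2[OF Q, symmetric])
    also have "\<dots> = emeasure (distr (?U \<Otimes>\<^sub>M ?N) ?N (\<lambda>(l, \<omega>). case_nat l \<omega>)) (lim -` A \<inter> space ?N)"
      unfolding Q_eq by (rule emeasure_distr[OF cn B, symmetric])
    also have "\<dots> = emeasure ?N (lim -` A \<inter> space ?N)" by (simp only: S.PiM_iter)
    also have "\<dots> = emeasure \<mu> A" unfolding \<mu>_def by (rule emeasure_distr[OF lim_meas A, symmetric])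
    finally show ?thesis .
  qed
  moreover have "prob_space \<mu>" unfolding \<mu>_def by (rule N.prob_space_distr[OF lim_meas])
  moreover have "sets \<mu> = sets (configs V)" by (simp add: \<mu>_def)
  ultimately have inv: "invariant_measure V step \<mu>" by (simp add: invariant_measure_def)
  have bound: "measure \<mu> {\<xi> \<in> space (configs V). \<xi> x = a} \<le> c"
    if x: "x \<in> V" and c: "\<And>n. measure ?N {\<omega> \<in> space ?N. ?b n \<omega> x = a} \<le> c" for x a c
  proof -
    let ?E = "\<lambda>m. {\<omega> \<in> space ?N. \<forall>n\<ge>m. ?b n \<omega> x = a}"
    have comp: "(\<lambda>\<xi>. \<xi> x) \<in> measurable (configs V) (count_space {0, 1})"
      unfolding configs_def using x by (rule measurable_component_singleton)
    have "(\<lambda>\<xi>. \<xi> x) -` ({0, 1} \<inter> {a}) \<inter> space (configs V) \<in> sets (configs V)"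
      by (rule measurable_sets[OF comp]) simp
    also have "(\<lambda>\<xi>. \<xi> x) -` ({0, 1} \<inter> {a}) \<inter> space (configs V) = {\<xi> \<in> space (configs V). \<xi> x = a}"
    proof -
      have "\<xi> x \<in> {0, 1}" if "\<xi> \<in> space (configs V)" for \<xi>
        using that x unfolding space_configs by (rule PiE_mem)
      then show ?thesis by blast
    qed
    finally have meas: "{\<xi> \<in> space (configs V). \<xi> x = a} \<in> sets (configs V)" .
    have "measure \<mu> {\<xi> \<in> space (configs V). \<xi> x = a} = measure ?N (lim -` {\<xi> \<in> space (configs V). \<xi> x = a} \<inter> space ?N)"
      unfolding \<mu>_def by (rule measure_distr[OF lim_meas meas])
    also have "\<dots> \<le> measure ?N (\<Union>m. ?E m)"
    proof (rule N.finite_measure_mono)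
      show "lim -` {\<xi> \<in> space (configs V). \<xi> x = a} \<inter> space ?N \<subseteq> (\<Union>m. ?E m)"
      proof
        fix \<omega> assume "\<omega> \<in> lim -` {\<xi> \<in> space (configs V). \<xi> x = a} \<inter> space ?N"
        then have *: "lim \<omega> x = a" "\<omega> \<in> space ?N" by simp_all
        from lim_eq[OF x, of \<omega>] obtain m where "\<forall>n\<ge>m. a = ?b n \<omega> x" unfolding *(1) by (elim exE)
        then have "\<omega> \<in> ?E m" using *(2) by auto
        then show "\<omega> \<in> (\<Union>m. ?E m)" by blast
      qed
      show "(\<Union>m. ?E m) \<in> sets ?N" using ev_lim[OF x] by (intro sets.countable_UN) blast
    qed
    also have "\<dots> \<le> c"
    proof (rule LIMSEQ_le_const2)
      show "(\<lambda>m. measure ?N (?E m)) \<longlonglongrightarrow> measure ?N (\<Union>m. ?E m)"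
      proof (rule N.finite_Lim_measure_incseq)
        show "range ?E \<subseteq> sets ?N" using ev_lim[OF x] by blast
        show "incseq ?E" unfolding incseq_def by (blast intro: le_trans)
      qed
      have "measure ?N (?E m) \<le> c" for m
      proof -
        have "measure ?N (?E m) \<le> measure ?N {\<omega> \<in> space ?N. ?b m \<omega> x = a}"
          using ev_eq[OF x] by (intro N.finite_measure_mono) auto
        then show ?thesis using c[of m] by linarith
      qed
      then show "\<exists>M. \<forall>m\<ge>M. measure ?N (?E m) \<le> c" by simp
    qed
    finally show ?thesis .
  qed
  show ?thesis
  proof (intro exI conjI ballI allI impI)
    show "invariant_measure V step \<mu>" by (rule inv)
  qed (rule bound, assumption, erule spec)
qed

end

definition all_zeros :: "'v set \<Rightarrow> 'v \<Rightarrow> nat" where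
  "all_zeros V = (\<lambda>x\<in>V. 0)"

context local_dynamics
begin

lemma from_past_le:
  assumes mono: "\<And>l \<eta> \<eta>'. \<lbrakk>\<eta> \<in> space (configs V); \<eta>' \<in> space (configs V); \<forall>x\<in>V. \<eta> x \<le> \<eta>' x\<rbrakk>
      \<Longrightarrow> \<forall>x\<in>V. step l \<eta> x \<le> step l \<eta>' x"
    and \<eta>: "\<eta> \<in> space (configs V)" and start: "\<And>l. \<forall>x\<in>V. step l \<eta> x \<le> \<eta> x"
  shows "\<forall>x\<in>V. from_past step \<eta> (Suc n) \<omega> x \<le> from_past step \<eta> n \<omega> x"
proof (induction n arbitrary: \<omega>)
  case (Suc n)
  from mono[OF from_past_in_configs[OF \<eta>] from_past_in_configs[OF \<eta>] Suc] show ?case by simp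
qed (simp add: start)

lemma from_past_ge:
  assumes mono: "\<And>l \<eta> \<eta>'. \<lbrakk>\<eta> \<in> space (configs V); \<eta>' \<in> space (configs V); \<forall>x\<in>V. \<eta> x \<le> \<eta>' x\<rbrakk>
      \<Longrightarrow> \<forall>x\<in>V. step l \<eta> x \<le> step l \<eta>' x"
    and \<eta>: "\<eta> \<in> space (configs V)" and start: "\<And>l. \<forall>x\<in>V. \<eta> x \<le> step l \<eta> x"
  shows "\<forall>x\<in>V. from_past step \<eta> n \<omega> x \<le> from_past step \<eta> (Suc n) \<omega> x"
proof (induction n arbitrary: \<omega>)
  case (Suc n)
  from mono[OF from_past_in_configs[OF \<eta>] from_past_in_configs[OF \<eta>] Suc] show ?case by simp
qed (simp add: start)

end

lemma antimono_nat_stabilises: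
  fixes f :: "nat \<Rightarrow> nat"
  assumes "\<And>n. f (Suc n) \<le> f n"
  shows "\<exists>m. \<forall>n\<ge>m. f n = f m"
proof -
  obtain m where m: "\<And>n. f m \<le> f n" using ex_has_least_nat[of "\<lambda>_. True" 0 f] by auto
  have "f n \<le> f m" if "m \<le> n" for n using lift_Suc_antimono_le[of f m n] assms that by blast
  with m show ?thesis by (intro exI[of _ m]) (simp add: order_antisym)
qed

lemma bounded_mono_nat_stabilises:
  fixes f :: "nat \<Rightarrow> nat"
  assumes mono: "\<And>n. f n \<le> f (Suc n)" and bound: "\<And>n. f n \<le> b"
  shows "\<exists>m. \<forall>n\<ge>m. f n = f m"
proof -
  obtain m where m: "\<forall>n\<ge>m. b - f n = b - f m"
    using antimono_nat_stabilises[of "\<lambda>n. b - f n"] mono by (auto simp: diff_le_mono2)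
  have "f n = f m" if "n \<ge> m" for n
  proof -
    have "b - f n = b - f m" using m that by blast
    then show ?thesis using bound[of n] bound[of m] by linarith
  qed
  then show ?thesis by blast
qed

text \<open>
  By monotonicity the coupling from the past decreases when started from all ones and increases when
  started from all zeros. At the site \<open>x\<close> the first limit is rarely zero and the second rarely
  one, so the two invariant laws cannot agree.
\<close>
lemma (in local_dynamics) multiple_invariant_measuresI:
  assumes mono: "\<And>l \<eta> \<eta>'. \<lbrakk>\<eta> \<in> space (configs V); \<eta>' \<in> space (configs V); \<forall>x\<in>V. \<eta> x \<le> \<eta>' x\<rbrakk>
      \<Longrightarrow> \<forall>x\<in>V. step l \<eta> x \<le> step l \<eta>' x"
    and x: "x \<in> V" and c: "c < 1 / 2"
    and ones: "\<And>n. measure (past_noise V)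
        {\<omega> \<in> space (past_noise V). from_past step (all_ones V) n \<omega> x = 0} \<le> c"
    and zeros: "\<And>n. measure (past_noise V)
        {\<omega> \<in> space (past_noise V). from_past step (all_zeros V) n \<omega> x = 1} \<le> c"
  shows "multiple_invariant_measures V step"
proof -
  have conf: "all_ones V \<in> space (configs V)" "all_zeros V \<in> space (configs V)"
    by (simp_all add: space_configs all_ones_def all_zeros_def)
  have bin: "\<eta> y \<in> {0, 1}" if "\<eta> \<in> space (configs V)" "y \<in> V" for \<eta> y
    using that unfolding space_configs by (rule PiE_mem)
  have top: "\<forall>y\<in>V. step l (all_ones V) y \<le> all_ones V y" for l
  proof
    fix y assume y: "y \<in> V"
    have "step l (all_ones V) y \<in> {0, 1}" by (rule bin[OF step_in_configs[OF conf(1)] y])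
    then show "step l (all_ones V) y \<le> all_ones V y" using y by (auto simp: all_ones_def)
  qed
  have bot: "\<forall>y\<in>V. all_zeros V y \<le> step l (all_zeros V) y" for l
    by (simp add: all_zeros_def)
  have down: "\<forall>y\<in>V. from_past step (all_ones V) (Suc n) \<omega> y \<le> from_past step (all_ones V) n \<omega> y" for n \<omega>
    by (rule from_past_le) (fact mono conf top)+
  have up: "\<forall>y\<in>V. from_past step (all_zeros V) n \<omega> y \<le> from_past step (all_zeros V) (Suc n) \<omega> y" for n \<omega>
    by (rule from_past_ge) (fact mono conf bot)+
  have s1: "\<forall>\<omega>. \<forall>y\<in>V. \<exists>m. \<forall>n\<ge>m. from_past step (all_ones V) n \<omega> y = from_past step (all_ones V) m \<omega> y"
    by (intro allI ballI, rule antimono_nat_stabilises) (rule bspec[OF down])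
  have s0: "\<forall>\<omega>. \<forall>y\<in>V. \<exists>m. \<forall>n\<ge>m. from_past step (all_zeros V) n \<omega> y = from_past step (all_zeros V) m \<omega> y"
  proof (intro allI ballI, rule bounded_mono_nat_stabilises)
    fix \<omega> y n assume y: "y \<in> V"
    show "from_past step (all_zeros V) n \<omega> y \<le> from_past step (all_zeros V) (Suc n) \<omega> y"
      by (rule bspec[OF up y])
    show "from_past step (all_zeros V) n \<omega> y \<le> 1"
      using bin[OF from_past_in_configs[OF conf(2)] y, of n \<omega>] by auto
  qed
  from stationary_limit[OF conf(1) s1] obtain \<mu> where \<mu>: "invariant_measure V step \<mu>"
    and mu0_bound: "\<forall>x\<in>V. \<forall>a c. (\<forall>n. measure (past_noise V)
        {\<omega> \<in> space (past_noise V). from_past step (all_ones V) n \<omega> x = a} \<le> c) \<longrightarrow>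
      measure \<mu> {\<xi> \<in> space (configs V). \<xi> x = a} \<le> c" by (elim exE conjE)
  have mu0: "measure \<mu> {\<xi> \<in> space (configs V). \<xi> x = 0} \<le> c"
    by (rule mu0_bound[rule_format, OF x]) (rule ones)
  from stationary_limit[OF conf(2) s0] obtain \<nu> where \<nu>: "invariant_measure V step \<nu>"
    and nu1_bound: "\<forall>x\<in>V. \<forall>a c. (\<forall>n. measure (past_noise V)
        {\<omega> \<in> space (past_noise V). from_past step (all_zeros V) n \<omega> x = a} \<le> c) \<longrightarrow>
      measure \<nu> {\<xi> \<in> space (configs V). \<xi> x = a} \<le> c" by (elim exE conjE)
  have nu1: "measure \<nu> {\<xi> \<in> space (configs V). \<xi> x = 1} \<le> c"
    by (rule nu1_bound[rule_format, OF x]) (rule zeros)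
  have "\<mu> \<noteq> \<nu>"
  proof
    assume "\<mu> = \<nu>"
    interpret prob_space \<mu> using \<mu> by (simp add: invariant_measure_def)
    have sets: "sets \<mu> = sets (configs V)" using \<mu> by (simp add: invariant_measure_def)
    then have space: "space \<mu> = space (configs V)" by (rule sets_eq_imp_space_eq)
    have coord: "(\<lambda>\<xi>. \<xi> x) \<in> measurable (configs V) (count_space {0, 1})"
      unfolding configs_def using x by (rule measurable_component_singleton)
    have ev: "{\<xi> \<in> space (configs V). \<xi> x = a} \<in> sets \<mu>" if "a \<in> {0, 1}" for a
    proof -
      have "(\<lambda>\<xi>. \<xi> x) -` {a} \<inter> space (configs V) \<in> sets (configs V)"
        using that by (intro measurable_sets[OF coord]) simp
      also have "(\<lambda>\<xi>. \<xi> x) -` {a} \<inter> space (configs V) = {\<xi> \<in> space (configs V). \<xi> x = a}" by blast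
      finally show ?thesis unfolding sets .
    qed
    have "space \<mu> = {\<xi> \<in> space (configs V). \<xi> x = 0} \<union> {\<xi> \<in> space (configs V). \<xi> x = 1}"
      using bin[OF _ x] unfolding space by blast
    then have "1 \<le> prob {\<xi> \<in> space (configs V). \<xi> x = 0} + prob {\<xi> \<in> space (configs V). \<xi> x = 1}"
      using measure_Un_le[OF ev[of 0] ev[of 1]] prob_space by simp
    then show False using mu0 nu1 c unfolding \<open>\<mu> = \<nu>\<close> by linarith
  qed
  with \<mu> \<nu> show ?thesis unfolding multiple_invariant_measures_def by blast
qed

section \<open>The two processes\<close>

context bounded_graph
begin

lemma nbr_count_measurable: "(\<lambda>\<eta>. real (nbr_count E \<eta> x)) \<in> borel_measurable (configs V)"
proof -
  have "(\<lambda>\<eta>. real (\<eta> y)) \<in> borel_measurable (configs V)" if "y \<in> nbrs E x" for y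
  proof -
    have "(\<lambda>\<eta>. \<eta> y) \<in> measurable (configs V) (count_space {0, 1})"
      unfolding configs_def using that nbrs_subset_V by (intro measurable_component_singleton) blast
    then show ?thesis by (rule measurable_compose) simp
  qed
  then have "(\<lambda>\<eta>. \<Sum>y\<in>nbrs E x. real (\<eta> y)) \<in> borel_measurable (configs V)"
    by (rule borel_measurable_sum)
  then show ?thesis by (simp add: nbr_count_def)
qed

lemma step_events:
  assumes "x \<in> V"
  defines "M \<equiv> configs V \<Otimes>\<^sub>M site_noise V"
  shows "{p \<in> space M. snd p x \<in> {a..b}} \<in> sets M" "{p \<in> space M. snd p x \<in> {a..<b}} \<in> sets M"
    "{p \<in> space M. m \<le> nbr_count E (fst p) x} \<in> sets M"
    "{p \<in> space M. real (nbr_count E (fst p) x) < r} \<in> sets M"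
    "{p \<in> space M. r < real (nbr_count E (fst p) x)} \<in> sets M"
    "(\<lambda>p. fst p x) \<in> measurable M (count_space {0, 1})"
proof -
  have "(\<lambda>l. l x) \<in> measurable (site_noise V) uniform01"
    using assms(1) by (rule measurable_component_singleton)
  then have "(\<lambda>l. l x) \<in> borel_measurable (site_noise V)"
    by (rule measurable_compose) (rule measurable_ident_sets, simp)
  from measurable_compose[OF measurable_snd this]
  have l [measurable]: "(\<lambda>p. snd p x) \<in> borel_measurable M" unfolding M_def .
  have n [measurable]: "(\<lambda>p. real (nbr_count E (fst p) x)) \<in> borel_measurable M"
    unfolding M_def by (rule measurable_compose[OF measurable_fst nbr_count_measurable])
  show "{p \<in> space M. snd p x \<in> {a..b}} \<in> sets M" "{p \<in> space M. snd p x \<in> {a..<b}} \<in> sets M"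
    "{p \<in> space M. real (nbr_count E (fst p) x) < r} \<in> sets M"
    "{p \<in> space M. r < real (nbr_count E (fst p) x)} \<in> sets M"
    by measurable
  have "{p \<in> space M. real m \<le> real (nbr_count E (fst p) x)} \<in> sets M" by measurable
  then show "{p \<in> space M. m \<le> nbr_count E (fst p) x} \<in> sets M" by simp
  have "(\<lambda>\<eta>. \<eta> x) \<in> measurable (configs V) (count_space {0, 1})"
    unfolding configs_def using assms(1) by (rule measurable_component_singleton)
  from measurable_compose[OF measurable_fst this]
  show "(\<lambda>p. fst p x) \<in> measurable M (count_space {0, 1})" unfolding M_def .
qed

lemma nbr_count_cong: "(\<And>y. y \<in> nbrs E x \<Longrightarrow> \<eta> y = \<eta>' y) \<Longrightarrow> nbr_count E \<eta> x = nbr_count E \<eta>' x"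
  unfolding nbr_count_def by (rule sum.cong) simp_all

lemma local_dynamics_consensus: "local_dynamics V (consensus_step V E j \<epsilon>)"
proof
  have "(\<lambda>p. \<lambda>x\<in>V. if snd p x \<in> {\<epsilon>..1} then (if j \<le> nbr_count E (fst p) x then 1 else 0) else 0)
      \<in> measurable (configs V \<Otimes>\<^sub>M site_noise V) (\<Pi>\<^sub>M x\<in>V. count_space {0, 1 :: nat})"
    by (intro measurable_restrict measurable_If step_events) simp_all
  then show "(\<lambda>(\<eta>, l). consensus_step V E j \<epsilon> l \<eta>) \<in> measurable (configs V \<Otimes>\<^sub>M site_noise V) (configs V)"
    unfolding configs_def[of V, symmetric] by (simp add: consensus_step_def case_prod_beta')
next
  fix x assume x: "x \<in> V"
  show "\<exists>W. finite W \<and> W \<subseteq> V \<and> (\<forall>l \<eta> \<eta>'. (\<forall>y\<in>W. \<eta> y = \<eta>' y)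
      \<longrightarrow> consensus_step V E j \<epsilon> l \<eta> x = consensus_step V E j \<epsilon> l \<eta>' x)"
  proof (intro exI[of _ "nbrs E x"] conjI allI impI)
    fix l and \<eta> \<eta>' :: "'v \<Rightarrow> nat" assume "\<forall>y\<in>nbrs E x. \<eta> y = \<eta>' y"
    then have "nbr_count E \<eta> x = nbr_count E \<eta>' x" by (intro nbr_count_cong) blast
    then show "consensus_step V E j \<epsilon> l \<eta> x = consensus_step V E j \<epsilon> l \<eta>' x"
      by (simp add: consensus_step_def)
  qed (simp_all add: nbrs_subset_V)
qed (simp_all add: consensus_step_def)

lemma local_dynamics_majority: "local_dynamics V (majority_step V E \<epsilon>)"
proof
  have "(\<lambda>p. \<lambda>x\<in>V. if snd p x \<in> {\<epsilon>..1} then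
        (if real (nbr_count E (fst p) x) < real (deg E x) / 2 then 0
         else if real (deg E x) / 2 < real (nbr_count E (fst p) x) then 1 else fst p x)
       else if snd p x \<in> {0..<\<epsilon>/2} then 0 else 1)
      \<in> measurable (configs V \<Otimes>\<^sub>M site_noise V) (\<Pi>\<^sub>M x\<in>V. count_space {0, 1 :: nat})"
    by (intro measurable_restrict measurable_If step_events) simp_all
  then show "(\<lambda>(\<eta>, l). majority_step V E \<epsilon> l \<eta>) \<in> measurable (configs V \<Otimes>\<^sub>M site_noise V) (configs V)"
    unfolding configs_def[of V, symmetric] by (simp add: majority_step_def case_prod_beta')
next
  fix l \<eta> x assume "\<eta> \<in> space (configs V)" "x \<in> V"
  then have "\<eta> x \<in> {0, 1}" unfolding space_configs by (rule PiE_mem)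
  then show "majority_step V E \<epsilon> l \<eta> x \<in> {0, 1}" using \<open>x \<in> V\<close> by (simp add: majority_step_def)
next
  fix x assume x: "x \<in> V"
  show "\<exists>W. finite W \<and> W \<subseteq> V \<and> (\<forall>l \<eta> \<eta>'. (\<forall>y\<in>W. \<eta> y = \<eta>' y)
      \<longrightarrow> majority_step V E \<epsilon> l \<eta> x = majority_step V E \<epsilon> l \<eta>' x)"
  proof (intro exI[of _ "insert x (nbrs E x)"] conjI allI impI)
    fix l and \<eta> \<eta>' :: "'v \<Rightarrow> nat" assume *: "\<forall>y\<in>insert x (nbrs E x). \<eta> y = \<eta>' y"
    then have "nbr_count E \<eta> x = nbr_count E \<eta>' x" by (intro nbr_count_cong) blast
    with * show "majority_step V E \<epsilon> l \<eta> x = majority_step V E \<epsilon> l \<eta>' x"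
      by (simp add: majority_step_def)
  qed (simp_all add: nbrs_subset_V x)
qed (simp_all add: majority_step_def)

lemma majority_step_mono:
  assumes le: "\<forall>x\<in>V. \<eta> x \<le> \<eta>' x" and "\<eta> \<in> space (configs V)"
  shows "\<forall>x\<in>V. majority_step V E \<epsilon> l \<eta> x \<le> majority_step V E \<epsilon> l \<eta>' x"
proof
  fix x assume x: "x \<in> V"
  have "\<eta> x \<in> {0, 1}" using assms(2) x unfolding space_configs by (rule PiE_mem)
  moreover have "\<eta> x \<le> \<eta>' x" using le x by blast
  moreover have "real (nbr_count E \<eta> x) \<le> real (nbr_count E \<eta>' x)"
    using le by (simp add: nbr_count_mono)
  ultimately show "majority_step V E \<epsilon> l \<eta> x \<le> majority_step V E \<epsilon> l \<eta>' x"
    using x by (auto simp: majority_step_def)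
qed

text \<open>
  With \<open>j > \<Delta> / 2\<close>, at least \<open>j\<close> ones among the neighbours are a strict majority, and the majority
  process is erased by the noise at most where the consensus process is.
\<close>
lemma majority_above_consensus:
  assumes j: "real (max_degree V E) / 2 < real j"
    and x: "x \<in> V" "trajectory (majority_step V E \<epsilon>) l (all_ones V) t x = 0"
  shows "x \<in> zeros j \<epsilon> l t"
proof -
  have "le_on (trajectory (consensus_step V E j \<epsilon>) l (all_ones V) t)
      (trajectory (majority_step V E \<epsilon>) l (all_ones V) t)"
  proof (rule trajectory_invariant)
    show "le_on (all_ones V) (all_ones V)" by (simp add: le_on_def)
  next
    fix l and \<eta> \<eta>' :: "'v \<Rightarrow> nat" assume le: "le_on \<eta> \<eta>'"
    show "le_on (consensus_step V E j \<epsilon> l \<eta>) (majority_step V E \<epsilon> l \<eta>')"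
      unfolding le_on_def
    proof
      fix y assume y: "y \<in> V"
      show "consensus_step V E j \<epsilon> l \<eta> y \<le> majority_step V E \<epsilon> l \<eta>' y"
      proof (cases "l y \<in> {\<epsilon>..1} \<and> j \<le> nbr_count E \<eta> y")
        case True
        have "nbr_count E \<eta> y \<le> nbr_count E \<eta>' y" using le by (intro nbr_count_mono) (simp add: le_on_def)
        with True have "real j \<le> real (nbr_count E \<eta>' y)" by linarith
        moreover have "real (deg E y) \<le> real (max_degree V E)" using deg_le_max_degree by simp
        ultimately have "real (deg E y) / 2 < real (nbr_count E \<eta>' y)" using j by linarith
        with True y show ?thesis by (simp add: majority_step_def consensus_step_def)
      next
        case False
        then have "consensus_step V E j \<epsilon> l \<eta> y = 0" using y by (auto simp: consensus_step_def)
        then show ?thesis by simp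
      qed
    qed
  qed
  then show ?thesis using x by (auto simp: le_on_def zeros_def)
qed

text \<open>
  The same comparison for the flipped process: wherever the consensus process has a one, the majority
  process from all zeros has a zero, because at least \<open>j\<close> of its neighbours are zeros.
\<close>
lemma majority_zeros_above_consensus:
  assumes j: "real (max_degree V E) / 2 < real j"
    and x: "x \<in> V" "trajectory (majority_step V E \<epsilon>) l (all_zeros V) t x = 1"
  shows "x \<in> zeros j \<epsilon> l t"
proof -
  define R where "R \<eta> \<eta>' \<longleftrightarrow> (\<forall>y\<in>V. \<eta> y + \<eta>' y \<le> (1 :: nat))" for \<eta> \<eta>' :: "'v \<Rightarrow> nat"
  have "R (trajectory (consensus_step V E j \<epsilon>) l (all_ones V) t)
      (trajectory (majority_step V E \<epsilon>) l (all_zeros V) t)"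
  proof (rule trajectory_invariant)
    show "R (all_ones V) (all_zeros V)" by (simp add: R_def all_ones_def all_zeros_def)
  next
    fix l and \<eta> \<eta>' :: "'v \<Rightarrow> nat" assume R: "R \<eta> \<eta>'"
    show "R (consensus_step V E j \<epsilon> l \<eta>) (majority_step V E \<epsilon> l \<eta>')"
      unfolding R_def
    proof
      fix y assume y: "y \<in> V"
      have "\<eta>' y \<le> 1" using R y unfolding R_def by (meson add_leD2)
      then have maj: "majority_step V E \<epsilon> l \<eta>' y \<le> 1" using y by (simp add: majority_step_def)
      show "consensus_step V E j \<epsilon> l \<eta> y + majority_step V E \<epsilon> l \<eta>' y \<le> 1"
      proof (cases "l y \<in> {\<epsilon>..1} \<and> j \<le> nbr_count E \<eta> y")
        case True
        have "nbr_count E \<eta> y + nbr_count E \<eta>' y = (\<Sum>z\<in>nbrs E y. \<eta> z + \<eta>' z)"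
          by (simp add: nbr_count_def sum.distrib)
        also have "\<dots> \<le> (\<Sum>z\<in>nbrs E y. 1)"
          using R nbrs_subset_V unfolding R_def by (intro sum_mono) blast
        also have "\<dots> = deg E y" by (simp add: deg_def)
        finally have "real (nbr_count E \<eta>' y) \<le> real (deg E y) - real j" using True by linarith
        moreover have "real (deg E y) \<le> real (max_degree V E)" using deg_le_max_degree by simp
        ultimately have "real (nbr_count E \<eta>' y) < real (deg E y) / 2" using j by linarith
        with True y show ?thesis by (simp add: majority_step_def consensus_step_def)
      next
        case False
        then have "consensus_step V E j \<epsilon> l \<eta> y = 0" using y by (auto simp: consensus_step_def)
        then show ?thesis using maj by simp
      qed
    qed
  qed
  then have "trajectory (consensus_step V E j \<epsilon>) l (all_ones V) t x = 0" using x unfolding R_def by fastforce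
  then show ?thesis using x(1) by (simp add: zeros_def)
qed

lemma consensus_from_all_zeros:
  assumes "1 \<le> j"
  shows "from_past (consensus_step V E j \<epsilon>) (all_zeros V) n \<omega> = all_zeros V"
proof -
  have "nbr_count E (all_zeros V) x = 0" for x
    unfolding nbr_count_def all_zeros_def using nbrs_subset_V by (intro sum.neutral) auto
  then have "consensus_step V E j \<epsilon> l (all_zeros V) = all_zeros V" for l
    using assms unfolding consensus_step_def all_zeros_def by (intro restrict_ext) simp
  then show ?thesis by (induction n arbitrary: \<omega>) simp_all
qed

end

section \<open>Coexistence of invariant measures at small noise\<close>

theorem theorem2p7:
  fixes V :: "'v set" and E :: "'v set set"
    and M :: "'w measure" and L :: "'v \<Rightarrow> nat \<Rightarrow> 'w \<Rightarrow> real"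
  assumes "simple_graph V E" and "connected_graph V E" and "infinite V" and "bounded_degree V E"
    and "iid_uniform_noise V M L"
  shows "(\<forall>j::nat. 1 \<le> j \<and> j \<le> min_degree V E \<and> chi_good V E j \<longrightarrow>
      (\<exists>\<epsilon>0>0. \<forall>\<epsilon>\<in>{0..\<epsilon>0}.
        multiple_invariant_measures V (consensus_step V E j \<epsilon>) \<and>
        (\<exists>c::real. 0 < c \<and> c < 1/2 \<and> (\<forall>t\<ge>1. \<forall>x\<in>V.
          measure M {\<omega> \<in> space M.
            trajectory (consensus_step V E j \<epsilon>) (\<lambda>y s. L y s \<omega>) (all_ones V) t x = 0} \<le> c))))
    \<and>
    (chi_good V E (nat \<lfloor>real (max_degree V E) / 2 + 1\<rfloor>) \<longrightarrow>
      (\<exists>\<epsilon>0>0. \<forall>\<epsilon>\<in>{0..\<epsilon>0}.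
        multiple_invariant_measures V (majority_step V E \<epsilon>) \<and>
        (\<exists>c::real. 0 < c \<and> c < 1/2 \<and> (\<forall>t\<ge>1. \<forall>x\<in>V.
          measure M {\<omega> \<in> space M.
            trajectory (majority_step V E \<epsilon>) (\<lambda>y s. L y s \<omega>) (all_ones V) t x = 0} \<le> c))))"
proof -
  interpret bounded_graph V E using assms(1,4) by unfold_locales
  have "V \<noteq> {}" using assms(3) by auto
  then obtain x0 where x0: "x0 \<in> V" by blast
  have "prob_space M" using assms(5) by (simp add: iid_uniform_noise_def)
  define rare where "rare j \<epsilon> \<longleftrightarrow>
      (\<forall>t A x. A \<subseteq> space M \<longrightarrow> (\<forall>\<omega>\<in>A. x \<in> zeros j \<epsilon> (\<lambda>y s. L y s \<omega>) t) \<longrightarrow> measure M A \<le> 1 / 3) \<and>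
      (\<forall>n A x. A \<subseteq> space (past_noise V) \<longrightarrow> (\<forall>\<omega>\<in>A. x \<in> zeros j \<epsilon> (\<lambda>y s. \<omega> (n - s) y) n)
         \<longrightarrow> measure (past_noise V) A \<le> 1 / 3)" for j \<epsilon>
  have ex_rare: "\<exists>\<epsilon>0>0. \<forall>\<epsilon>\<in>{0..\<epsilon>0}. rare j \<epsilon>" if good: "chi_good V E j" for j
  proof -
    obtain k where k: "\<forall>\<epsilon> l t. \<forall>x\<in>zeros j \<epsilon> l t. \<exists>S. error_cluster E k (errors \<epsilon> l) (x, t) S \<and> S \<subseteq> V \<times> {1..t}"
      using chi_good_error_cluster[OF \<open>V \<noteq> {}\<close> good] by (elim exE)
    show ?thesis unfolding rare_def
    proof (intro exI[of _ "peierls_threshold V E k"] conjI ballI allI impI peierls_threshold_pos)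
      fix \<epsilon> t A x assume eps: "\<epsilon> \<in> {0..peierls_threshold V E k}" and A: "A \<subseteq> space M"
        "\<forall>\<omega>\<in>A. x \<in> zeros j \<epsilon> (\<lambda>y s. L y s \<omega>) t"
      then have eps': "0 \<le> \<epsilon>" "\<epsilon> \<le> peierls_threshold V E k" "\<epsilon> \<le> 1"
        using peierls_threshold_le_1[of V E k] by simp_all
      show "measure M A \<le> 1 / 3"
        by (rule peierls_estimate[OF \<open>prob_space M\<close> independent_errors_iid[OF assms(5) eps'(1,3)] eps'(1,2) A(1)])
          (rule k[rule_format], erule A(2)[rule_format])
    next
      fix \<epsilon> n x and A :: "(nat \<Rightarrow> 'v \<Rightarrow> real) set"
      assume eps: "\<epsilon> \<in> {0..peierls_threshold V E k}" and A: "A \<subseteq> space (past_noise V)"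
        "\<forall>\<omega>\<in>A. x \<in> zeros j \<epsilon> (\<lambda>y s. \<omega> (n - s) y) n"
      then have eps': "0 \<le> \<epsilon>" "\<epsilon> \<le> peierls_threshold V E k" "\<epsilon> \<le> 1"
        using peierls_threshold_le_1[of V E k] by simp_all
      show "measure (past_noise V) A \<le> 1 / 3"
        by (rule peierls_estimate[OF prob_space_past_noise independent_errors_past_noise[OF eps'(1,3)] eps'(1,2) A(1)])
          (rule k[rule_format], erule A(2)[rule_format])
    qed
  qed
  show ?thesis
  proof (intro conjI allI impI)
    fix j assume j: "1 \<le> j \<and> j \<le> min_degree V E \<and> chi_good V E j"
    then obtain \<epsilon>0 where e0: "\<epsilon>0 > 0" "\<forall>\<epsilon>\<in>{0..\<epsilon>0}. rare j \<epsilon>"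
      using ex_rare by blast
    show "\<exists>\<epsilon>0>0. \<forall>\<epsilon>\<in>{0..\<epsilon>0}.
        multiple_invariant_measures V (consensus_step V E j \<epsilon>) \<and>
        (\<exists>c::real. 0 < c \<and> c < 1/2 \<and> (\<forall>t\<ge>1. \<forall>x\<in>V.
          measure M {\<omega> \<in> space M.
            trajectory (consensus_step V E j \<epsilon>) (\<lambda>y s. L y s \<omega>) (all_ones V) t x = 0} \<le> c))"
    proof (rule exI[of _ \<epsilon>0], intro conjI ballI e0(1))
      fix \<epsilon> assume \<epsilon>: "\<epsilon> \<in> {0..\<epsilon>0}"
      note e = bspec[OF e0(2) \<epsilon>, unfolded rare_def]
      interpret local_dynamics V "consensus_step V E j \<epsilon>" by (rule local_dynamics_consensus)
      show "multiple_invariant_measures V (consensus_step V E j \<epsilon>)"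
      proof (rule multiple_invariant_measuresI[OF _ x0])
        fix l and \<eta> \<eta>' :: "'v \<Rightarrow> nat" assume "\<forall>x\<in>V. \<eta> x \<le> \<eta>' x"
        then show "\<forall>x\<in>V. consensus_step V E j \<epsilon> l \<eta> x \<le> consensus_step V E j \<epsilon> l \<eta>' x"
          using consensus_step_mono[of \<eta> \<eta>' j j] by (simp add: le_on_def)
      next
        fix n
        show "measure (past_noise V) {\<omega> \<in> space (past_noise V).
            from_past (consensus_step V E j \<epsilon>) (all_ones V) n \<omega> x0 = 0} \<le> 1 / 3"
          by (rule e[THEN conjunct2, rule_format, where x = x0 and n = n])
            (auto simp: from_past_eq_trajectory zeros_def x0)
        show "measure (past_noise V) {\<omega> \<in> space (past_noise V).
            from_past (consensus_step V E j \<epsilon>) (all_zeros V) n \<omega> x0 = 1} \<le> 1 / 3"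
          using j x0 by (simp add: consensus_from_all_zeros) (simp add: all_zeros_def)
      qed simp
      show "\<exists>c::real. 0 < c \<and> c < 1/2 \<and> (\<forall>t\<ge>1. \<forall>x\<in>V.
          measure M {\<omega> \<in> space M.
            trajectory (consensus_step V E j \<epsilon>) (\<lambda>y s. L y s \<omega>) (all_ones V) t x = 0} \<le> c)"
      proof (intro exI[of _ "1 / 3"] conjI allI impI ballI)
        fix t :: nat and x assume "1 \<le> t" "x \<in> V"
        then show "measure M {\<omega> \<in> space M.
              trajectory (consensus_step V E j \<epsilon>) (\<lambda>y s. L y s \<omega>) (all_ones V) t x = 0} \<le> 1 / 3"
          by (intro e[THEN conjunct1, rule_format, where x = x and t = t]) (auto simp: zeros_def)
      qed simp_all
    qed
  next
    define j where "j = nat \<lfloor>real (max_degree V E) / 2 + 1\<rfloor>"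
    assume "chi_good V E (nat \<lfloor>real (max_degree V E) / 2 + 1\<rfloor>)"
    then have good: "chi_good V E j" by (simp only: j_def)
    have j: "real (max_degree V E) / 2 < real j" unfolding j_def by linarith
    from ex_rare[OF good] obtain \<epsilon>0 where e0: "\<epsilon>0 > 0" "\<forall>\<epsilon>\<in>{0..\<epsilon>0}. rare j \<epsilon>"
      by blast
    show "\<exists>\<epsilon>0>0. \<forall>\<epsilon>\<in>{0..\<epsilon>0}.
        multiple_invariant_measures V (majority_step V E \<epsilon>) \<and>
        (\<exists>c::real. 0 < c \<and> c < 1/2 \<and> (\<forall>t\<ge>1. \<forall>x\<in>V.
          measure M {\<omega> \<in> space M.
            trajectory (majority_step V E \<epsilon>) (\<lambda>y s. L y s \<omega>) (all_ones V) t x = 0} \<le> c))"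
    proof (rule exI[of _ \<epsilon>0], intro conjI ballI e0(1))
      fix \<epsilon> assume \<epsilon>: "\<epsilon> \<in> {0..\<epsilon>0}"
      note e = bspec[OF e0(2) \<epsilon>, unfolded rare_def]
      interpret local_dynamics V "majority_step V E \<epsilon>" by (rule local_dynamics_majority)
      show "multiple_invariant_measures V (majority_step V E \<epsilon>)"
      proof (rule multiple_invariant_measuresI[OF _ x0])
        fix l and \<eta> \<eta>' :: "'v \<Rightarrow> nat" assume "\<forall>x\<in>V. \<eta> x \<le> \<eta>' x" "\<eta> \<in> space (configs V)"
        then show "\<forall>x\<in>V. majority_step V E \<epsilon> l \<eta> x \<le> majority_step V E \<epsilon> l \<eta>' x"
          by (rule majority_step_mono)
      next
        fix n
        show "measure (past_noise V) {\<omega> \<in> space (past_noise V).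
            from_past (majority_step V E \<epsilon>) (all_ones V) n \<omega> x0 = 0} \<le> 1 / 3"
          by (rule e[THEN conjunct2, rule_format, where x = x0 and n = n])
            (auto simp: from_past_eq_trajectory intro: majority_above_consensus[OF j x0])
        show "measure (past_noise V) {\<omega> \<in> space (past_noise V).
            from_past (majority_step V E \<epsilon>) (all_zeros V) n \<omega> x0 = 1} \<le> 1 / 3"
          by (rule e[THEN conjunct2, rule_format, where x = x0 and n = n])
            (auto simp: from_past_eq_trajectory intro: majority_zeros_above_consensus[OF j x0])
      qed simp
      show "\<exists>c::real. 0 < c \<and> c < 1/2 \<and> (\<forall>t\<ge>1. \<forall>x\<in>V.
          measure M {\<omega> \<in> space M.
            trajectory (majority_step V E \<epsilon>) (\<lambda>y s. L y s \<omega>) (all_ones V) t x = 0} \<le> c)"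
      proof (intro exI[of _ "1 / 3"] conjI allI impI ballI)
        fix t :: nat and x assume "1 \<le> t" and x: "x \<in> V"
        show "measure M {\<omega> \<in> space M.
              trajectory (majority_step V E \<epsilon>) (\<lambda>y s. L y s \<omega>) (all_ones V) t x = 0} \<le> 1 / 3"
          by (rule e[THEN conjunct1, rule_format, where x = x and t = t])
            (auto intro: majority_above_consensus[OF j x])
      qed simp_all
    qed
  qed
qed

end
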